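(* Let $\Gamma$ be the quiver of type $A_\infty$ with vertex set $I=\mathbb{Z}$. Let $\Lambda=\sum_{i\in I}\lambda_i\cdot i\in\mathbb{N}[I]$ and let $\ell=\ell(\Lambda)=\sum_{i\in I}\lambda_i$ be the level of $\Lambda$. Let $\nu\in\mathbb{N}[I]$ with $|\nu|=m$. Then $x_{r,\mathbf{i}}^{\,\ell}=0$ in $R_\nu^\Lambda$ for any sequence $\mathbf{i}\in\mathrm{Seq}(\nu)$ and any $1\le r\le m$.
   Context: **Cartan form.** $I=\mathbb{Z}$; $i\cdot i=2$, $i\cdot j=-1$ if $|i-j|=1$, and $i\cdot j=0$ otherwise. $\mathbb{N}[I]$ is the set of finite formal sums $\nu=\sum_i\nu_i\cdot i$ with $\nu_i\in\mathbb{N}=\{0,1,2,\dots\}$; $|\nu|=\sum_i\nu_i$. $\mathrm{Seq}(\nu)$ is the set of sequences $\mathbf{i}=i_1\cdots i_m\in I^m$ ($m=|\nu|$) in which each $i$ appears exactly $\nu_i$ times. $s_r\mathbf{i}$ denotes $\mathbf{i}$ with entries $r$ and $r+1$ exchanged. **The ring $R(\nu)$.** Over a field $\Bbbk$, $R(\nu)$ is the $\Bbbk$-algebra generated by $1_{\mathbf{i}}$, $x_{r,\mathbf{i}}$ ($1\le r\le m$), $\delta_{r,\mathbf{i}}$ ($1\le r<m$), for $\mathbf{i}\in\mathrm{Seq}(\nu)$ (vertical strands coloured by $\mathbf{i}$, a dot on strand $r$, a crossing of strands $r,r+1$; in a product $ab$ the diagram $a$ is placed on top of $b$), with relations: (1)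 the $1_{\mathbf{i}}$ are orthogonal idempotents with sum $1$; $x_{r,\mathbf{i}}=1_{\mathbf{i}}x_{r,\mathbf{i}}1_{\mathbf{i}}$; $\delta_{r,\mathbf{i}}=1_{s_r\mathbf{i}}\,\delta_{r,\mathbf{i}}\,1_{\mathbf{i}}$; (2) $x_{r,\mathbf{i}}x_{t,\mathbf{i}}=x_{t,\mathbf{i}}x_{r,\mathbf{i}}$; $\delta_{r,\mathbf{i}}x_{t,\mathbf{i}}=x_{t,s_r\mathbf{i}}\delta_{r,\mathbf{i}}$ if $t\ne r,r+1$; $\delta_{r,s_t\mathbf{i}}\delta_{t,\mathbf{i}}=\delta_{t,s_r\mathbf{i}}\delta_{r,\mathbf{i}}$ if $|r-t|>1$; (3) $\delta_{r,s_r\mathbf{i}}\delta_{r,\mathbf{i}}$ equals $0$ if $i_r=i_{r+1}$, equals $1_{\mathbf{i}}$ if $i_r\cdot i_{r+1}=0$, and equals $x_{r,\mathbf{i}}+x_{r+1,\mathbf{i}}$ if $i_r\cdot i_{r+1}=-1$; (4) if $i_r\neq i_{r+1}$: $x_{r,s_r\mathbf{i}}\delta_{r,\mathbf{i}}=\delta_{r,\mathbf{i}}x_{r+1,\mathbf{i}}$ and $x_{r+1,s_r\mathbf{i}}\delta_{r,\mathbf{i}}=\delta_{r,\mathbf{i}}x_{r,\mathbf{i}}$; (5) if $i_r=i_{r+1}$: $x_{r,\mathbf{i}}\delta_{r,\mathbf{i}}-\delta_{r,\mathbf{i}}x_{r+1,\mathbf{i}}=1_{\mathbf{i}}$ and $\delta_{r,\mathbf{i}}x_{r,\mathbf{i}}-x_{r+1,\mathbf{i}}\delta_{r,\mathbf{i}}=1_{\mathbf{i}}$;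 (6) (omitting the evident sequence subscripts) $(\delta_r\delta_{r+1}\delta_r-\delta_{r+1}\delta_r\delta_{r+1})1_{\mathbf{i}}$ equals $1_{\mathbf{i}}$ if $i_r=i_{r+2}$ and $i_r\cdot i_{r+1}=-1$, and equals $0$ otherwise. **Cyclotomic quotient.** For $\Lambda=\sum_i\lambda_i\cdot i\in\mathbb{N}[I]$, $R_\nu^\Lambda=R(\nu)/\mathcal{J}_\Lambda$, where $\mathcal{J}_\Lambda$ is the two-sided ideal generated by $x_{1,\mathbf{i}}^{\lambda_{i_1}}$ for all $\mathbf{i}\in\mathrm{Seq}(\nu)$. Convention: $x_{r,\mathbf{i}}^0=1_{\mathbf{i}}$. *)

theory Defs
  imports
    "HOL-Algebra.Ideal"
    "HOL-Algebra.QuotRing"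
    "HOL-Library.Poly_Mapping"
    "HOL-Combinatorics.Multiset_Permutations"
begin

section \<open>Free algebras\<close>

text \<open>
  The free monoid on \<open>'a\<close>.  The finitely supported functions from it to a field are the
  free associative unital algebra on \<open>'a\<close>, with convolution as the product.
\<close>

datatype 'a word = Word (letters: "'a list")

instantiation word :: (type) monoid_add
begin

definition zero_word :: "'a word" where "0 = Word []"

definition plus_word :: "'a word \<Rightarrow> 'a word \<Rightarrow> 'a word"
  where "v + w = Word (letters v @ letters w)"

instance
  by standard (simp_all add: zero_word_def plus_word_def)

end

definition gen :: "'a \<Rightarrow> ('a word \<Rightarrow>\<^sub>0 'k::field)" where
  "gen a = Poly_Mapping.single (Word [a]) 1"

text \<open>
  The free algebra on a set of generators \<open>G\<close>, as a ring.  Only the ring structure is recorded: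
  scalars are central elements of it, so its two-sided ring ideals are the ideals of the algebra.
\<close>

definition free_algebra :: "'a set \<Rightarrow> ('a word \<Rightarrow>\<^sub>0 'k::field) ring" where
  "free_algebra G =
     \<lparr>carrier = {f. \<forall>w \<in> Poly_Mapping.keys f. set (letters w) \<subseteq> G},
      monoid.mult = (\<lambda>f g. f * g), one = 1, ring.zero = 0, add = (\<lambda>f g. f + g)\<rparr>"

lemma free_algebra_sels [simp]:
  "f \<otimes>\<^bsub>free_algebra G\<^esub> g = f * g" "\<one>\<^bsub>free_algebra G\<^esub> = 1"
  "f \<oplus>\<^bsub>free_algebra G\<^esub> g = f + g" "\<zero>\<^bsub>free_algebra G\<^esub> = 0"
  by (simp_all add: free_algebra_def)

lemma free_algebra_closed [simp]:
  "0 \<in> carrier (free_algebra G)" "1 \<in> carrier (free_algebra G)"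
  "f \<in> carrier (free_algebra G) \<Longrightarrow> - f \<in> carrier (free_algebra G)"
  "f \<in> carrier (free_algebra G) \<Longrightarrow> g \<in> carrier (free_algebra G) \<Longrightarrow> f + g \<in> carrier (free_algebra G)"
  "f \<in> carrier (free_algebra G) \<Longrightarrow> g \<in> carrier (free_algebra G) \<Longrightarrow> f - g \<in> carrier (free_algebra G)"
  "f \<in> carrier (free_algebra G) \<Longrightarrow> g \<in> carrier (free_algebra G) \<Longrightarrow> f * g \<in> carrier (free_algebra G)"
  "a \<in> G \<Longrightarrow> gen a \<in> carrier (free_algebra G)"
  for f g :: "'a word \<Rightarrow>\<^sub>0 'k::field"
proof -
  have uminus: "Poly_Mapping.keys (- f) = Poly_Mapping.keys f" for f :: "'a word \<Rightarrow>\<^sub>0 'k"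
    by (auto simp: in_keys_iff)
  have add: "f + g \<in> carrier (free_algebra G)"
    if "f \<in> carrier (free_algebra G)" "g \<in> carrier (free_algebra G)" for f g :: "'a word \<Rightarrow>\<^sub>0 'k"
    using that keys_add[of f g] by (auto simp: free_algebra_def)
  show "0 \<in> carrier (free_algebra G)" "1 \<in> carrier (free_algebra G)"
    by (auto simp: free_algebra_def zero_word_def)
  show "- f \<in> carrier (free_algebra G)" if "f \<in> carrier (free_algebra G)"
    using that by (simp add: free_algebra_def uminus)
  show "f + g \<in> carrier (free_algebra G)"
    if "f \<in> carrier (free_algebra G)" "g \<in> carrier (free_algebra G)"
    using that by (rule add)
  show "f - g \<in> carrier (free_algebra G)"
    if "f \<in> carrier (free_algebra G)" "g \<in> carrier (free_algebra G)"
  proof -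
    have "- g \<in> carrier (free_algebra G)"
      using \<open>g \<in> _\<close> by (simp add: free_algebra_def uminus)
    from add[OF \<open>f \<in> _\<close> this] show ?thesis by (simp only: diff_conv_add_uminus)
  qed
  show "f * g \<in> carrier (free_algebra G)"
    if "f \<in> carrier (free_algebra G)" "g \<in> carrier (free_algebra G)"
  proof -
    have "set (letters w) \<subseteq> G" if w: "w \<in> Poly_Mapping.keys (f * g)" for w
    proof -
      obtain u v where "w = u + v" "u \<in> Poly_Mapping.keys f" "v \<in> Poly_Mapping.keys g"
        using w keys_mult[of f g] by blast
      then show ?thesis
        using \<open>f \<in> _\<close> \<open>g \<in> _\<close> by (simp add: free_algebra_def plus_word_def)
    qed
    then show ?thesis by (simp add: free_algebra_def)
  qed
  show "gen a \<in> carrier (free_algebra G)" if "a \<in> G"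
    using that by (simp add: free_algebra_def gen_def)
qed

lemma free_algebra_sum_closed:
  "(\<And>a. a \<in> A \<Longrightarrow> f a \<in> carrier (free_algebra G)) \<Longrightarrow> sum f A \<in> carrier (free_algebra G)"
  by (induction A rule: infinite_finite_induct) simp_all

lemma ring_free_algebra: "ring (free_algebra G)"
proof (rule ringI)
  show "abelian_group (free_algebra G)"
  proof (rule abelian_groupI)
    fix x assume "x \<in> carrier (free_algebra G)"
    then show "\<exists>y\<in>carrier (free_algebra G). y \<oplus>\<^bsub>free_algebra G\<^esub> x = \<zero>\<^bsub>free_algebra G\<^esub>"
      by (intro bexI[of _ "- x"]) simp_all
  qed (simp_all add: ac_simps)
  show "Group.monoid (free_algebra G)"
    by (rule monoidI) (simp_all add: ac_simps)
qed (simp_all add: algebra_simps)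


section \<open>The rings \<open>R(\<nu>)\<close> for the quiver of type \<open>A\<^sub>\<infinity>\<close>\<close>

text \<open>
  Elements of \<open>\<nat>[I]\<close> for \<open>I = \<int>\<close> are multisets of integers: \<open>\<nu>\<^sub>i\<close> is \<^term>\<open>count \<nu> i\<close>, and both
  \<open>|\<nu>|\<close> and the level of a weight are given by \<^term>\<open>size\<close>.
\<close>

definition cartan :: "int \<Rightarrow> int \<Rightarrow> int" where
  "cartan i j = (if i = j then 2 else if \<bar>i - j\<bar> = 1 then - 1 else 0)"

abbreviation Seq :: "int multiset \<Rightarrow> int list set" where
  "Seq \<nu> \<equiv> permutations_of_multiset \<nu>"

text \<open>Strand positions \<open>r\<close> are counted from 1, list positions from 0.\<close>

definition col :: "int list \<Rightarrow> nat \<Rightarrow> int" where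
  "col i r = i ! (r - 1)"

definition swap :: "nat \<Rightarrow> int list \<Rightarrow> int list" where
  "swap r i = i[r - 1 := col i (r + 1), r := col i r]"

datatype klr_gen = Idempotent "int list" | Dot nat "int list" | Cross nat "int list"

definition klr_gens :: "int multiset \<Rightarrow> klr_gen set" where
  "klr_gens \<nu> =
     {Idempotent i | i. i \<in> Seq \<nu>} \<union>
     {Dot r i | r i. i \<in> Seq \<nu> \<and> 1 \<le> r \<and> r \<le> size \<nu>} \<union>
     {Cross r i | r i. i \<in> Seq \<nu> \<and> 1 \<le> r \<and> r < size \<nu>}"

type_synonym 'k klr_free = "klr_gen word \<Rightarrow>\<^sub>0 'k"

text \<open>The generators \<open>1\<^sub>i\<close>, \<open>x\<^sub>r\<^sub>,\<^sub>i\<close> and \<open>\<delta>\<^sub>r\<^sub>,\<^sub>i\<close> as elements of the free algebra.\<close>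

abbreviation ee :: "int list \<Rightarrow> 'k::field klr_free" where "ee i \<equiv> gen (Idempotent i)"
abbreviation xx :: "nat \<Rightarrow> int list \<Rightarrow> 'k::field klr_free" where "xx r i \<equiv> gen (Dot r i)"
abbreviation dd :: "nat \<Rightarrow> int list \<Rightarrow> 'k::field klr_free" where "dd r i \<equiv> gen (Cross r i)"

text \<open>
  A relation \<open>a = b\<close> is recorded as the element \<open>a - b\<close> of the free algebra.  In a product \<open>a * b\<close>
  the diagram \<open>a\<close> is on top of \<open>b\<close>, so the bottom sequence is that of the rightmost factor.
\<close>

inductive_set klr_relators :: "int multiset \<Rightarrow> 'k::field klr_free set" for \<nu> :: "int multiset" where
  idem: "i \<in> Seq \<nu> \<Longrightarrow> ee i * ee i - ee i \<in> klr_relators \<nu>"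
| orth: "i \<in> Seq \<nu> \<Longrightarrow> j \<in> Seq \<nu> \<Longrightarrow> i \<noteq> j \<Longrightarrow> ee i * ee j \<in> klr_relators \<nu>"
| unit: "(\<Sum>i\<in>Seq \<nu>. ee i) - 1 \<in> klr_relators \<nu>"
| dot_idem: "i \<in> Seq \<nu> \<Longrightarrow> 1 \<le> r \<Longrightarrow> r \<le> size \<nu> \<Longrightarrow>
    xx r i - ee i * xx r i * ee i \<in> klr_relators \<nu>"
| cross_idem: "i \<in> Seq \<nu> \<Longrightarrow> 1 \<le> r \<Longrightarrow> r < size \<nu> \<Longrightarrow>
    dd r i - ee (swap r i) * dd r i * ee i \<in> klr_relators \<nu>"
| dot_dot: "i \<in> Seq \<nu> \<Longrightarrow> 1 \<le> r \<Longrightarrow> r \<le> size \<nu> \<Longrightarrow> 1 \<le> t \<Longrightarrow> t \<le> size \<nu> \<Longrightarrow>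
    xx r i * xx t i - xx t i * xx r i \<in> klr_relators \<nu>"
| cross_dot_far: "i \<in> Seq \<nu> \<Longrightarrow> 1 \<le> r \<Longrightarrow> r < size \<nu> \<Longrightarrow> 1 \<le> t \<Longrightarrow> t \<le> size \<nu> \<Longrightarrow>
    t \<noteq> r \<Longrightarrow> t \<noteq> r + 1 \<Longrightarrow>
    dd r i * xx t i - xx t (swap r i) * dd r i \<in> klr_relators \<nu>"
| cross_cross_far: "i \<in> Seq \<nu> \<Longrightarrow> 1 \<le> r \<Longrightarrow> r < size \<nu> \<Longrightarrow> 1 \<le> t \<Longrightarrow> t < size \<nu> \<Longrightarrow>
    \<bar>int r - int t\<bar> > 1 \<Longrightarrow>
    dd r (swap t i) * dd t i - dd t (swap r i) * dd r i \<in> klr_relators \<nu>"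
| cross_sq_same: "i \<in> Seq \<nu> \<Longrightarrow> 1 \<le> r \<Longrightarrow> r < size \<nu> \<Longrightarrow> col i r = col i (r + 1) \<Longrightarrow>
    dd r (swap r i) * dd r i \<in> klr_relators \<nu>"
| cross_sq_far: "i \<in> Seq \<nu> \<Longrightarrow> 1 \<le> r \<Longrightarrow> r < size \<nu> \<Longrightarrow> cartan (col i r) (col i (r + 1)) = 0 \<Longrightarrow>
    dd r (swap r i) * dd r i - ee i \<in> klr_relators \<nu>"
| cross_sq_adj: "i \<in> Seq \<nu> \<Longrightarrow> 1 \<le> r \<Longrightarrow> r < size \<nu> \<Longrightarrow> cartan (col i r) (col i (r + 1)) = - 1 \<Longrightarrow>
    dd r (swap r i) * dd r i - (xx r i + xx (r + 1) i) \<in> klr_relators \<nu>"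
| slide_diff1: "i \<in> Seq \<nu> \<Longrightarrow> 1 \<le> r \<Longrightarrow> r < size \<nu> \<Longrightarrow> col i r \<noteq> col i (r + 1) \<Longrightarrow>
    xx r (swap r i) * dd r i - dd r i * xx (r + 1) i \<in> klr_relators \<nu>"
| slide_diff2: "i \<in> Seq \<nu> \<Longrightarrow> 1 \<le> r \<Longrightarrow> r < size \<nu> \<Longrightarrow> col i r \<noteq> col i (r + 1) \<Longrightarrow>
    xx (r + 1) (swap r i) * dd r i - dd r i * xx r i \<in> klr_relators \<nu>"
| slide_same1: "i \<in> Seq \<nu> \<Longrightarrow> 1 \<le> r \<Longrightarrow> r < size \<nu> \<Longrightarrow> col i r = col i (r + 1) \<Longrightarrow>
    (xx r i * dd r i - dd r i * xx (r + 1) i) - ee i \<in> klr_relators \<nu>"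
| slide_same2: "i \<in> Seq \<nu> \<Longrightarrow> 1 \<le> r \<Longrightarrow> r < size \<nu> \<Longrightarrow> col i r = col i (r + 1) \<Longrightarrow>
    (dd r i * xx r i - xx (r + 1) i * dd r i) - ee i \<in> klr_relators \<nu>"
| braid: "i \<in> Seq \<nu> \<Longrightarrow> 1 \<le> r \<Longrightarrow> r + 1 < size \<nu> \<Longrightarrow>
    (dd r (swap (r + 1) (swap r i)) * dd (r + 1) (swap r i) * dd r i
      - dd (r + 1) (swap r (swap (r + 1) i)) * dd r (swap (r + 1) i) * dd (r + 1) i)
    - (if col i r = col i (r + 2) \<and> cartan (col i r) (col i (r + 1)) = - 1 then ee i else 0)
    \<in> klr_relators \<nu>"

definition klr_ideal :: "int multiset \<Rightarrow> 'k::field klr_free set" where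
  "klr_ideal \<nu> = Idl\<^bsub>free_algebra (klr_gens \<nu>)\<^esub> (klr_relators \<nu>)"

definition klr :: "int multiset \<Rightarrow> 'k::field klr_free set ring" where
  "klr \<nu> = free_algebra (klr_gens \<nu>) Quot klr_ideal \<nu>"

definition klr_class :: "int multiset \<Rightarrow> 'k::field klr_free \<Rightarrow> 'k klr_free set" where
  "klr_class \<nu> a = klr_ideal \<nu> +>\<^bsub>free_algebra (klr_gens \<nu>)\<^esub> a"


section \<open>Cyclotomic quotients\<close>

text \<open>
  \<open>x\<^sub>r\<^sub>,\<^sub>i\<^sup>n\<close> in \<open>R(\<nu>)\<close>, with the convention that the 0-th power is the idempotent \<open>1\<^sub>i\<close>, not the unit
  of the ring.
\<close>

definition dot_pow :: "int multiset \<Rightarrow> nat \<Rightarrow> int list \<Rightarrow> nat \<Rightarrow> 'k::field klr_free set" where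
  "dot_pow \<nu> r i n =
     (if n = 0 then klr_class \<nu> (ee i) else klr_class \<nu> (xx r i) [^]\<^bsub>klr \<nu>\<^esub> n)"

text \<open>
  For \<open>\<nu> = 0\<close> the only sequence is empty and has no first strand, so there is no generator
  and the quotient is \<open>R(0)\<close>.
\<close>

definition cyc_ideal :: "int multiset \<Rightarrow> int multiset \<Rightarrow> 'k::field klr_free set set" where
  "cyc_ideal \<nu> \<Lambda> =
     Idl\<^bsub>klr \<nu>\<^esub> {dot_pow \<nu> 1 i (count \<Lambda> (col i 1)) | i. i \<in> Seq \<nu> \<and> i \<noteq> []}"

definition cyc_klr :: "int multiset \<Rightarrow> int multiset \<Rightarrow> 'k::field klr_free set set ring" where
  "cyc_klr \<nu> \<Lambda> = klr \<nu> Quot cyc_ideal \<nu> \<Lambda>"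

definition cyc_class ::
    "int multiset \<Rightarrow> int multiset \<Rightarrow> 'k::field klr_free set \<Rightarrow> 'k klr_free set set" where
  "cyc_class \<nu> \<Lambda> a = cyc_ideal \<nu> \<Lambda> +>\<^bsub>klr \<nu>\<^esub> a"

definition cyc_dot_pow ::
    "int multiset \<Rightarrow> int multiset \<Rightarrow> nat \<Rightarrow> int list \<Rightarrow> nat \<Rightarrow> 'k::field klr_free set set" where
  "cyc_dot_pow \<nu> \<Lambda> r i n =
     (if n = 0 then cyc_class \<nu> \<Lambda> (klr_class \<nu> (ee i))
      else cyc_class \<nu> \<Lambda> (klr_class \<nu> (xx r i)) [^]\<^bsub>cyc_klr \<nu> \<Lambda>\<^esub> n)"


section \<open>The quotients are taken by genuine ideals\<close>

lemma swap_in_Seq: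
  assumes "i \<in> Seq \<nu>" "1 \<le> r" "r < size \<nu>"
  shows "swap r i \<in> Seq \<nu>"
proof -
  have m: "mset i = \<nu>" and l: "length i = size \<nu>"
    using assms(1) by (auto simp: permutations_of_multiset_def)
  have "mset (swap r i) = mset i"
    unfolding swap_def col_def using assms l mset_swap[of r i "r - 1"] by simp
  then show ?thesis using m by (simp add: permutations_of_multiset_def)
qed

lemma klr_gens_iff [simp]:
  "Idempotent i \<in> klr_gens \<nu> \<longleftrightarrow> i \<in> Seq \<nu>"
  "Dot r i \<in> klr_gens \<nu> \<longleftrightarrow> i \<in> Seq \<nu> \<and> 1 \<le> r \<and> r \<le> size \<nu>"
  "Cross r i \<in> klr_gens \<nu> \<longleftrightarrow> i \<in> Seq \<nu> \<and> 1 \<le> r \<and> r < size \<nu>"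
  by (auto simp: klr_gens_def)

lemma klr_relators_closed: "klr_relators \<nu> \<subseteq> carrier (free_algebra (klr_gens \<nu>))"
proof
  fix f :: "'k::field klr_free"
  assume "f \<in> klr_relators \<nu>"
  then show "f \<in> carrier (free_algebra (klr_gens \<nu>))"
    by cases (simp_all add: free_algebra_sum_closed swap_in_Seq)
qed

lemma ideal_klr_ideal: "ideal (klr_ideal \<nu>) (free_algebra (klr_gens \<nu>))"
  unfolding klr_ideal_def
  by (rule ring.genideal_ideal[OF ring_free_algebra klr_relators_closed])

lemma ring_klr: "ring (klr \<nu>)"
  unfolding klr_def by (rule ideal.quotient_is_ring[OF ideal_klr_ideal])

lemma klr_class_closed:
  "a \<in> carrier (free_algebra (klr_gens \<nu>)) \<Longrightarrow> klr_class \<nu> a \<in> carrier (klr \<nu>)"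
  unfolding klr_class_def klr_def
  using ring_hom_closed[OF ideal.rcos_ring_hom[OF ideal_klr_ideal]] .

lemma dot_pow_closed:
  assumes "i \<in> Seq \<nu>" "1 \<le> r" "r \<le> size \<nu>"
  shows "dot_pow \<nu> r i n \<in> carrier (klr \<nu>)"
  unfolding dot_pow_def using assms
  by (auto intro!: klr_class_closed monoid.nat_pow_closed ring.is_monoid ring_klr)

lemma ideal_cyc_ideal: "ideal (cyc_ideal \<nu> \<Lambda>) (klr \<nu>)"
proof -
  have "1 \<le> size \<nu>" if "i \<in> Seq \<nu>" "i \<noteq> []" for i
    using that by (cases i) (auto simp: permutations_of_multiset_def)
  then show ?thesis
    unfolding cyc_ideal_def
    by (intro ring.genideal_ideal[OF ring_klr]) (auto intro!: dot_pow_closed)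
qed

lemma ring_cyc_klr: "ring (cyc_klr \<nu> \<Lambda>)"
  unfolding cyc_klr_def by (rule ideal.quotient_is_ring[OF ideal_cyc_ideal])

end

theory Submission
  imports Defs
begin

text \<open>
  Put \<open>y\<^sub>r = (-1)\<^bsup>i\<^sub>r\<^esup> x\<^sub>r\<close>, so that for adjacent colours \<open>\<delta>\<^sub>r\<^sup>2\<close> becomes \<open>\<plusminus>(y\<^sub>r - y\<^sub>r\<^sub>+\<^sub>1)\<close>.  For a colour \<open>c\<close>
  and a sequence \<open>i\<close> consider the Laurent series in \<open>1/z\<close>
  \<open>\<theta>\<^sub>c(i) = z\<^sup>u \<Prod>(z - y\<^sub>s) / \<Prod>(z - y\<^sub>t)\<close>, where \<open>u\<close> is the sum of the \<open>\<lambda>\<^sub>j\<close> with \<open>j \<ge> c\<close>, \<open>s\<close> runs over the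
  strands of colour \<open>c - 1\<close> and \<open>t\<close> over those of colour \<open>c\<close>.  In the semisimple picture, where \<open>i\<close> is
  the residue sequence of a standard multitableau, its roots are the components whose boundary
  path has an edge of a fixed direction at content \<open>c\<close>; a box of content \<open>c\<close> can only be added to such a
  component.  Accordingly \<open>\<theta>\<^sub>c(i)\<close> is a polynomial on \<open>1\<^sub>i\<close>, and it annihilates \<open>y\<close> for the last strand of
  the sequence \<open>i c\<close>.  The reflected series \<open>\<theta>'\<close>, for the weights \<open>\<lambda>\<^sub>j\<close> with \<open>j \<le> c - 1\<close> and with the two
  products interchanged, satisfies \<open>\<theta>\<^sub>c \<theta>' = z\<^sup>\<ell>\<close>, and hence \<open>y\<^sup>\<ell> = 0\<close>.
\<close>


section \<open>Polynomials in commuting elements of a ring\<close>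

text \<open>
  Polynomials in \<open>z\<close> are lists of coefficients, constant term first: \<open>diff_quotient a g\<close> represents
  \<open>(g(z) - g(a)) / (z - a)\<close> and \<open>linear_mult a p g\<close> represents \<open>p + (z - a) g(z)\<close>.
\<close>

primrec horner :: "'r::ring_1 list \<Rightarrow> 'r \<Rightarrow> 'r" where
  "horner [] z = 0"
| "horner (a # g) z = a + z * horner g z"

primrec diff_quotient :: "'r::ring_1 \<Rightarrow> 'r list \<Rightarrow> 'r list" where
  "diff_quotient a [] = []"
| "diff_quotient a (b # g) = horner g a # diff_quotient a g"

primrec linear_mult :: "'r::ring_1 \<Rightarrow> 'r \<Rightarrow> 'r list \<Rightarrow> 'r list" where
  "linear_mult a p [] = [p]"
| "linear_mult a p (b # g) = (p - a * b) # linear_mult a b g"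

lemma horner_linear_mult: "z * a = a * z \<Longrightarrow> horner (linear_mult a p g) z = p + (z - a) * horner g z"
proof (induction g arbitrary: p)
  case (Cons b g)
  have z: "(z - a) * z = z * (z - a)"
    using Cons.prems by (simp add: algebra_simps)
  have "horner (linear_mult a p (b # g)) z = p + (z - a) * b + (z * (z - a)) * horner g z"
    unfolding linear_mult.simps horner.simps Cons.IH[OF Cons.prems] by (simp add: algebra_simps)
  also have "\<dots> = p + (z - a) * horner (b # g) z"
    by (simp add: distrib_left left_diff_distrib mult.assoc add.assoc flip: z)
  finally show ?case .
qed simp

lemma horner_diff_quotient: "z * a = a * z \<Longrightarrow> (z - a) * horner (diff_quotient a g) z = horner g z - horner g a"
proof (induction g)
  case (Cons b g)
  have z: "(z - a) * z = z * (z - a)"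
    using Cons.prems by (simp add: algebra_simps)
  have "(z - a) * horner (diff_quotient a (b # g)) z = (z - a) * horner g a + ((z - a) * z) * horner (diff_quotient a g) z"
    by (simp add: distrib_left mult.assoc)
  also have "\<dots> = (z - a) * horner g a + z * ((z - a) * horner (diff_quotient a g) z)"
    by (simp add: z mult.assoc)
  also have "\<dots> = horner (b # g) z - horner (b # g) a"
    unfolding Cons.IH[OF Cons.prems] by (simp add: algebra_simps)
  finally show ?case .
qed simp

lemma horner_monomial: "horner (replicate n 0 @ [1]) z = z ^ n"
  by (induction n) simp_all

text \<open>Integral polynomials in the entries of \<open>y\<close> with index in \<open>S\<close>, in some order of the factors.\<close>

inductive polyfun :: "nat set \<Rightarrow> ((nat \<Rightarrow> 'r::ring_1) \<Rightarrow> 'r) \<Rightarrow> bool" for S where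
  zero: "polyfun S (\<lambda>_. 0)"
| one: "polyfun S (\<lambda>_. 1)"
| var: "n \<in> S \<Longrightarrow> polyfun S (\<lambda>y. y n)"
| add: "polyfun S F \<Longrightarrow> polyfun S G \<Longrightarrow> polyfun S (\<lambda>y. F y + G y)"
| diff: "polyfun S F \<Longrightarrow> polyfun S G \<Longrightarrow> polyfun S (\<lambda>y. F y - G y)"
| mult: "polyfun S F \<Longrightarrow> polyfun S G \<Longrightarrow> polyfun S (\<lambda>y. F y * G y)"

text \<open>Coefficient lists are kept as functions of \<open>y\<close>, so that passing a crossing
  becomes a substitution in \<open>y\<close>; \<open>S\<close> bounds the strands that can
  occur.\<close>

inductive polylist :: "nat set \<Rightarrow> ((nat \<Rightarrow> 'r::ring_1) \<Rightarrow> 'r list) \<Rightarrow> bool" for S where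
  Nil: "polylist S (\<lambda>_. [])"
| Cons: "polyfun S F \<Longrightarrow> polylist S G \<Longrightarrow> polylist S (\<lambda>y. F y # G y)"

lemma polyfun_mono: "polyfun S F \<Longrightarrow> S \<subseteq> T \<Longrightarrow> polyfun T F"
  by (induction rule: polyfun.induct) (auto intro: polyfun.intros)

lemma polylist_mono: "polylist S G \<Longrightarrow> S \<subseteq> T \<Longrightarrow> polylist T G"
  by (induction rule: polylist.induct) (auto intro: polylist.intros polyfun_mono)

lemma polyfun_cong: "polyfun S F \<Longrightarrow> (\<And>n. n \<in> S \<Longrightarrow> y n = y' n) \<Longrightarrow> F y = F y'"
  by (induction rule: polyfun.induct) auto

lemma polylist_cong: "polylist S G \<Longrightarrow> (\<And>n. n \<in> S \<Longrightarrow> y n = y' n) \<Longrightarrow> G y = G y'"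
  by (induction rule: polylist.induct) (auto intro: polyfun_cong)

text \<open>Moving strands acts on dots by an index map \<open>f\<close>. The new support is not
  tracked, hence \<open>UNIV\<close>.\<close>

lemma polyfun_comp: "polyfun S F \<Longrightarrow> polyfun UNIV (\<lambda>y. F (\<lambda>n. y (f n)))"
  by (induction rule: polyfun.induct) (auto intro: polyfun.intros)

lemma polyfun_horner: "polylist S G \<Longrightarrow> polyfun S F \<Longrightarrow> polyfun S (\<lambda>y. horner (G y) (F y))"
  by (induction rule: polylist.induct) (auto intro: polyfun.intros)

lemma polylist_diff_quotient: "polylist S G \<Longrightarrow> polyfun S F \<Longrightarrow> polylist S (\<lambda>y. diff_quotient (F y) (G y))"
  by (induction rule: polylist.induct) (auto intro: polylist.intros polyfun_horner)

lemma polylist_linear_mult: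
  "polylist S G \<Longrightarrow> polyfun S F \<Longrightarrow> polyfun S H \<Longrightarrow> polylist S (\<lambda>y. linear_mult (F y) (H y) (G y))"
proof (induction arbitrary: H rule: polylist.induct)
  case (Cons F' G)
  then show ?case
    using polylist.Cons[OF polyfun.diff[OF Cons.prems(2) polyfun.mult[OF Cons.prems(1) Cons.hyps(1)]]]
    by simp
qed (auto intro: polylist.intros)

lemma polylist_monomial: "polylist S (\<lambda>_. replicate n 0 @ [1])"
  by (induction n) (auto intro: polylist.intros polyfun.intros)

text \<open>
  The divisions by \<open>z - y\<close> discard the remainder, which vanishes only after multiplication by the
  idempotent of the sequence.
\<close>

primrec theta_rev :: "(int \<Rightarrow> nat) \<Rightarrow> int \<Rightarrow> int list \<Rightarrow> (nat \<Rightarrow> 'r::ring_1) \<Rightarrow> 'r list" where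
  "theta_rev U c [] y = replicate (U c) 0 @ [1]"
| "theta_rev U c (p # k) y =
     (if p = c then diff_quotient (y (length k)) (theta_rev U c k y)
      else if p = c - 1 then linear_mult (y (length k)) 0 (theta_rev U c k y)
      else theta_rev U c k y)"

text \<open>The reversal makes the last strand the first one removed by the recursion, with
  \<open>length k\<close> as its position counted from 0.\<close>

definition theta :: "(int \<Rightarrow> nat) \<Rightarrow> int \<Rightarrow> int list \<Rightarrow> (nat \<Rightarrow> 'r::ring_1) \<Rightarrow> 'r list" where
  "theta U c k y = theta_rev U c (rev k) y"

lemma theta_Nil [simp]: "theta U c [] y = replicate (U c) 0 @ [1]"
  by (simp add: theta_def)

lemma theta_snoc:
  "theta U c (k @ [p]) y =
     (if p = c then diff_quotient (y (length k)) (theta U c k y)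
      else if p = c - 1 then linear_mult (y (length k)) 0 (theta U c k y)
      else theta U c k y)"
  by (simp add: theta_def)

text \<open>Only the colours \<open>c - 1\<close> and \<open>c\<close> change the series, so strands
  above \<open>c\<close> can be absorbed into the sequence.\<close>

lemma theta_append_above: "\<forall>p\<in>set w. c < p \<Longrightarrow> theta U c (k @ w) y = theta U c k y"
proof (induction w rule: rev_induct)
  case (snoc p w)
  then show ?case using theta_snoc[of U c "k @ w" p y] by auto
qed simp

lemma polylist_theta:
  "polylist {..<length k} (theta U c k :: (nat \<Rightarrow> 'r::ring_1) \<Rightarrow> 'r list)"
proof (induction k rule: rev_induct)
  case Nil
  have "theta U c [] = (\<lambda>_ :: nat \<Rightarrow> 'r. replicate (U c) 0 @ [1])"
    by (rule ext) (rule theta_Nil)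
  then show ?case by (simp only: polylist_monomial)
next
  case (snoc p k)
  have *: "polylist {..<length (k @ [p])} (theta U c k :: (nat \<Rightarrow> 'r) \<Rightarrow> 'r list)"
    using polylist_mono[OF snoc.IH] by fastforce
  have v: "polyfun {..<length (k @ [p])} (\<lambda>y :: nat \<Rightarrow> 'r. y (length k))"
    by (rule polyfun.var) simp
  have "theta U c (k @ [p]) = (\<lambda>y :: nat \<Rightarrow> 'r. if p = c then diff_quotient (y (length k)) (theta U c k y)
      else if p = c - 1 then linear_mult (y (length k)) 0 (theta U c k y)
      else theta U c k y)"
    by (rule ext) (rule theta_snoc)
  then show ?case
    using * polylist_diff_quotient[OF * v] polylist_linear_mult[OF * v polyfun.zero]
    by (cases "p = c"; cases "p = c - 1") simp_all
qed

section \<open>Descending runs of colours\<close>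

primrec descending :: "int \<Rightarrow> nat \<Rightarrow> int list" where
  "descending c 0 = []"
| "descending c (Suc s) = (c + int (Suc s)) # descending c s"

lemma length_descending [simp]: "length (descending c s) = s"
  by (induction s) simp_all

lemma set_descending: "set (descending c s) = {c + 1..c + int s}"
  by (induction s) auto

lemma descending_add: "descending c (s + t) = descending (c + int t) s @ descending c t"
  by (induction s) (simp_all add: algebra_simps)

text \<open>A run stops one above its base, which keeps the strand \<open>c\<close> carrying the dot
  explicit; absorbing that strand lowers the base by one.\<close>

lemma descending_snoc: "descending c s @ c # b = descending (c - 1) (Suc s) @ b"
  using descending_add[of "c - 1" s 1] by simp

lemma descending_Suc_snoc: "descending c (Suc s) = descending (c + 1) s @ [c + 1]"
  using descending_add[of c s 1] by simp


section \<open>The annihilating polynomial of the last strand\<close>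

text \<open>
  Strands are numbered from 0 here.  \<open>U c\<close> stands for the sum of the weights \<open>W j\<close> with \<open>j \<ge> c\<close>.
\<close>

locale klr_relations =
  fixes e :: "int list \<Rightarrow> 'r::ring_1" and Y d :: "nat \<Rightarrow> 'r" and W U :: "int \<Rightarrow> nat"
    and sg :: "int \<Rightarrow> 'r"
  assumes sg: "sg c = 1 \<or> sg c = - 1"
    and ee: "e i * e i = e i"
    and Y_Y: "Y n * Y k = Y k * Y n"
    and Y_e: "Y n * e i = e i * Y n"
    and d_e: "d (length a) * e (a @ p # q # b) = e (a @ q # p # b) * d (length a)"
    and d_Y_far: "k \<noteq> n \<Longrightarrow> k \<noteq> Suc n \<Longrightarrow> d n * Y k = Y k * d n"
    and dd_same: "d (length a) * d (length a) * e (a @ p # p # b) = 0"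
    and dd_far: "\<bar>p - q\<bar> \<ge> 2 \<Longrightarrow> d (length a) * d (length a) * e (a @ p # q # b) = e (a @ p # q # b)"
    and dd_adj: "\<bar>p - q\<bar> = 1 \<Longrightarrow> d (length a) * d (length a) * e (a @ p # q # b)
       = sg p * ((Y (length a) - Y (Suc (length a))) * e (a @ p # q # b))"
    and Y_d1: "p \<noteq> q \<Longrightarrow> Y (length a) * d (length a) * e (a @ p # q # b)
       = d (length a) * Y (Suc (length a)) * e (a @ p # q # b)"
    and Y_d2: "p \<noteq> q \<Longrightarrow> Y (Suc (length a)) * d (length a) * e (a @ p # q # b)
       = d (length a) * Y (length a) * e (a @ p # q # b)"
    and dY_same: "d (length a) * Y (length a) * e (a @ p # p # b)
       - Y (Suc (length a)) * d (length a) * e (a @ p # p # b) = sg p * e (a @ p # p # b)"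
    and braid: "\<bar>p - q\<bar> = 1 \<Longrightarrow>
       d (length a) * d (Suc (length a)) * d (length a) * e (a @ p # q # p # b)
       - d (Suc (length a)) * d (length a) * d (Suc (length a)) * e (a @ p # q # p # b)
       = e (a @ p # q # p # b)"
    and cyc: "Y 0 ^ W c * e (c # b) = 0"
    and U: "U c = W c + U (c + 1)"
begin

section \<open>Commutation of dot polynomials with dots, idempotents and crossings\<close>

lemma sg_cancel: "sg c * x = 0 \<Longrightarrow> x = 0"
  using sg[of c] by auto

lemma sg_comm: "sg c * x = x * sg c"
  using sg[of c] by auto

lemma polyfun_Y: "polyfun S F \<Longrightarrow> F Y * Y n = Y n * F Y"
proof (induction rule: polyfun.induct)
  case (mult F G)
  then show ?case by (metis mult.assoc)
qed (simp_all add: algebra_simps Y_Y)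

lemma polyfun_e: "polyfun S F \<Longrightarrow> F Y * e i = e i * F Y"
proof (induction rule: polyfun.induct)
  case (mult F G)
  then show ?case by (metis mult.assoc)
qed (simp_all add: algebra_simps Y_e)

lemma polyfun_polyfun: "polyfun S F \<Longrightarrow> polyfun T G \<Longrightarrow> F Y * G Y = G Y * F Y"
proof (induction rule: polyfun.induct)
  case (mult F G)
  then show ?case by (metis mult.assoc)
qed (simp_all add: algebra_simps polyfun_Y)

lemma polyfun_d: "polyfun S F \<Longrightarrow> n \<notin> S \<Longrightarrow> Suc n \<notin> S \<Longrightarrow> F Y * d n = d n * F Y"
proof (induction rule: polyfun.induct)
  case (var k)
  then show ?case by (metis d_Y_far)
next
  case (mult F G)
  then show ?case by (metis mult.assoc)
qed (simp_all add: algebra_simps)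

section \<open>Passing annihilation through crossings of different colours\<close>

lemma polyfun_swap:
  assumes "p \<noteq> q"
  shows "polyfun S F \<Longrightarrow> F (\<lambda>k. Y (transpose (length a) (Suc (length a)) k)) * d (length a) * e (a @ p # q # b)
    = d (length a) * F Y * e (a @ p # q # b)"
proof (induction rule: polyfun.induct)
  case (var k)
  then show ?case using assms Y_d1 Y_d2 d_Y_far
    by (cases "k = length a \<or> k = Suc (length a)") auto
next
  case (mult F G)
  let ?t = "\<lambda>k. Y (transpose (length a) (Suc (length a)) k)" and ?i = "a @ p # q # b"
  have "F ?t * G ?t * d (length a) * e ?i = F ?t * (d (length a) * G Y * e ?i)"
    using mult.IH(2) by (simp add: mult.assoc)
  \<comment> \<open>The idempotent has to stand next to the crossing before the hypothesis for
    \<open>F\<close> applies, so \<open>G Y\<close> is passed through it.\<close>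
  also have "\<dots> = F ?t * d (length a) * e ?i * G Y"
    using polyfun_e[OF mult.hyps(2)] by (simp add: mult.assoc)
  also have "\<dots> = d (length a) * (F Y * (e ?i * G Y))"
    using mult.IH(1) by (simp add: mult.assoc)
  also have "\<dots> = d (length a) * (F Y * G Y) * e ?i"
    using polyfun_e[OF mult.hyps(2)] by (simp add: mult.assoc)
  finally show ?case .
qed (simp_all add: algebra_simps)

lemma polyfun_swap':
  assumes "p \<noteq> q" "polyfun S F"
  shows "F Y * d (length a) * e (a @ p # q # b)
    = d (length a) * F (\<lambda>k. Y (transpose (length a) (Suc (length a)) k)) * e (a @ p # q # b)"
  using polyfun_swap[OF assms(1) polyfun_comp[OF assms(2), of "transpose (length a) (Suc (length a))"], of a b]
  by simp

text \<open>Of the two crossings, the upper one starts from the sequence with \<open>q\<close>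
  before \<open>p\<close>. Pushed below it, \<open>F Y\<close> becomes the transposed polynomial,
  which annihilates that idempotent.\<close>

lemma swap_dd:
  assumes "p \<noteq> q" "polyfun S F"
    and "F (\<lambda>k. Y (transpose (length a) (Suc (length a)) k)) * e (a @ q # p # b) = 0"
  shows "F Y * (d (length a) * d (length a) * e (a @ p # q # b)) = 0"
proof -
  have "F Y * (d (length a) * d (length a) * e (a @ p # q # b))
      = (F Y * d (length a) * e (a @ q # p # b)) * d (length a)"
    by (simp add: mult.assoc flip: d_e[of a p q b])
  also have "\<dots> = 0"
    using polyfun_swap'[OF _ assms(2), of q p a b] assms(1,3) by (simp add: mult.assoc)
  finally show ?thesis .
qed

lemma far_swap:
  assumes "\<bar>p - q\<bar> \<ge> 2" "polyfun S F"
    and "F (\<lambda>k. Y (transpose (length a) (Suc (length a)) k)) * e (a @ q # p # b) = 0"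
  shows "F Y * e (a @ p # q # b) = 0"
  using swap_dd[of p q, OF _ assms(2,3)] dd_far[OF assms(1), of a b] assms(1) by force

lemma adj_swap:
  assumes "\<bar>p - q\<bar> = 1" "polyfun S F"
    and "F (\<lambda>k. Y (transpose (length a) (Suc (length a)) k)) * e (a @ q # p # b) = 0"
  shows "F Y * (Y (length a) - Y (Suc (length a))) * e (a @ p # q # b) = 0"
proof -
  have "sg p * (F Y * (Y (length a) - Y (Suc (length a))) * e (a @ p # q # b)) = 0"
    using swap_dd[of p q, OF _ assms(2,3)] dd_adj[OF assms(1), of a b] assms(1)
    by (force simp: mult.assoc sg_comm)
  then show ?thesis by (rule sg_cancel)
qed

text \<open>A strand far from all of \<open>u\<close> passes it by repeated use of
  \<open>far_swap\<close>. The index map sends the strand \<open>p\<close> to its new position and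
  shifts the strands of \<open>u\<close> down by one.\<close>

lemma move_right:
  assumes "\<forall>q\<in>set u. \<bar>p - q\<bar> \<ge> 2" "polyfun S F"
    and "F (\<lambda>k. Y (if k = length a then length a + length u
            else if length a < k \<and> k \<le> length a + length u then k - 1 else k))
          * e (a @ u @ p # b) = 0"
  shows "F Y * e (a @ p # u @ b) = 0"
  using assms
proof (induction u arbitrary: a F S)
  case Nil
  have "(\<lambda>k. Y (if k = length a then length a + length []
            else if length a < k \<and> k \<le> length a + length [] then k - 1 else k)) = Y"
    by (rule ext) simp
  with Nil(3) show ?case unfolding append_Nil by metis
next
  case (Cons q u)
  let ?t = "transpose (length a) (Suc (length a))"
  let ?F = "\<lambda>y. F (\<lambda>k. y (?t k))"
  have "(\<lambda>k. Y (if ?t k = length (a @ [q]) then length (a @ [q]) + length u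
            else if length (a @ [q]) < ?t k \<and> ?t k \<le> length (a @ [q]) + length u then ?t k - 1 else ?t k))
     = (\<lambda>k. Y (if k = length a then length a + length (q # u)
            else if length a < k \<and> k \<le> length a + length (q # u) then k - 1 else k))"
    by (rule ext) (auto simp: transpose_def)
  then have "?F Y * e ((a @ [q]) @ p # u @ b) = 0"
    using Cons.prems by (intro Cons.IH[OF _ polyfun_comp[OF Cons.prems(2)]]) simp_all
  then show ?case
    using Cons.prems by (auto intro: far_swap)
qed

lemma move_left_pow:
  assumes "\<forall>q\<in>set u. \<bar>q - p\<bar> \<ge> 2" "Y (length a) ^ n * e (a @ p # u @ b) = 0"
  shows "Y (length a + length u) ^ n * e (a @ u @ p # b) = 0"
  using assms
proof (induction u arbitrary: b rule: rev_induct)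
  case (snoc q u)
  have pw: "polyfun UNIV (\<lambda>y::nat\<Rightarrow>'r. y k ^ n)" for k
    by (induction n) (simp_all add: polyfun.one polyfun.mult polyfun.var)
  have "Y (length a + length u) ^ n * e (a @ u @ p # q # b) = 0"
    using snoc by simp
  then show ?case
    using snoc.prems far_swap[of q p UNIV "\<lambda>y. y (length a + length (u @ [q])) ^ n" "a @ u" b] pw
    by simp
qed simp

section \<open>The nilHecke and braid relations applied to annihilating polynomials\<close>

lemma crossing_horner_same:
  assumes G: "polylist S G" "length a \<notin> S" "Suc (length a) \<notin> S"
  shows "d (length a) * horner (G Y) (Y (length a)) * e (a @ c # c # b)
     - horner (G Y) (Y (Suc (length a))) * d (length a) * e (a @ c # c # b)
     = sg c * horner (diff_quotient (Y (length a)) (G Y)) (Y (Suc (length a))) * e (a @ c # c # b)"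
  using assms
proof (induction rule: polylist.induct)
  case (Cons F G)
  let ?n = "length a" and ?i = "a @ c # c # b"
  let ?g = "horner (G Y) (Y ?n)" and ?h = "horner (G Y) (Y (Suc ?n))"
  let ?q = "horner (diff_quotient (Y ?n) (G Y)) (Y (Suc ?n))"
  have g: "?g * e ?i = e ?i * ?g"
    using polyfun_e[OF polyfun_horner[OF polylist_mono[OF Cons.hyps(2) subset_UNIV] polyfun.var[of ?n]]] by simp
  \<comment> \<open>One power of the dot is peeled off: the relation for a single dot gives one
    summand of the divided difference, and the induction hypothesis gives the rest.\<close>
  have "d ?n * Y ?n * ?g * e ?i - Y (Suc ?n) * ?h * d ?n * e ?i
      = (d ?n * Y ?n * e ?i - Y (Suc ?n) * d ?n * e ?i) * ?g
        + Y (Suc ?n) * (d ?n * ?g * e ?i - ?h * d ?n * e ?i)"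
    using g by (simp add: algebra_simps)
  also have "\<dots> = sg c * (e ?i * ?g) + Y (Suc ?n) * (sg c * ?q * e ?i)"
    unfolding dY_same Cons.IH[OF Cons.prems] by (simp only: mult.assoc)
  also have "\<dots> = sg c * (?g + Y (Suc ?n) * ?q) * e ?i"
    unfolding g[symmetric] distrib_left distrib_right mult.assoc[symmetric] sg_comm[of c "Y (Suc ?n)"] ..
  finally show ?case
    using polyfun_d[OF Cons.hyps(1) Cons.prems] by (simp add: algebra_simps)
qed simp

text \<open>Let \<open>q\<close> be the divided difference and \<open>h\<close> the polynomial at
  the second dot. By the preceding formula \<open>q e\<close> is \<open>h d e\<close> up to sign, so
  \<open>q d e\<close> is \<open>h d d e\<close> up to sign and vanishes. The nilHecke relation
  writes \<open>e\<close> through terms with a crossing, hence \<open>q e\<close> vanishes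
  too.\<close>

lemma divided_difference_zero:
  assumes G: "polylist S G" "length a \<notin> S" "Suc (length a) \<notin> S"
    and 0: "horner (G Y) (Y (length a)) * e (a @ c # c # b) = 0"
  shows "horner (diff_quotient (Y (length a)) (G Y)) (Y (Suc (length a))) * e (a @ c # c # b) = 0"
proof -
  let ?n = "length a" and ?i = "a @ c # c # b"
  let ?h = "horner (G Y) (Y (Suc ?n))" and ?q = "horner (diff_quotient (Y ?n) (G Y)) (Y (Suc ?n))"
  have q: "polyfun UNIV (\<lambda>y. horner (diff_quotient (y ?n) (G y)) (y (Suc ?n)))"
    using polylist_mono[OF G(1) subset_UNIV] by (intro polyfun_horner polylist_diff_quotient polyfun.var) auto
  have 1: "sg c * ?q * e ?i = - (?h * d ?n * e ?i)"
    using crossing_horner_same[OF G, of c b] 0 by (simp add: mult.assoc)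
  have "sg c * (?q * d ?n * e ?i) = sg c * ?q * e ?i * d ?n"
    by (simp add: mult.assoc d_e)
  also have "\<dots> = - (?h * (d ?n * d ?n * e ?i))"
    unfolding 1 by (simp add: mult.assoc flip: d_e[of a c c b])
  also have "\<dots> = 0" by (simp add: dd_same)
  finally have qd: "?q * d ?n * e ?i = 0" by (rule sg_cancel)
  have "?q * (d ?n * Y ?n * e ?i) = ?q * d ?n * e ?i * Y ?n"
    by (simp only: mult.assoc Y_e)
  moreover have "?q * (Y (Suc ?n) * d ?n * e ?i) = Y (Suc ?n) * (?q * d ?n * e ?i)"
    using polyfun_Y[OF q, of "Suc ?n"] by (simp only: mult.assoc[symmetric])
  ultimately have "?q * (sg c * e ?i) = 0"
    unfolding dY_same[symmetric] right_diff_distrib qd by simp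
  moreover have "sg c * (?q * e ?i) = ?q * (sg c * e ?i)"
    using sg_comm[of c ?q] by (simp only: mult.assoc[symmetric])
  ultimately have "sg c * (?q * e ?i) = 0" by simp
  then show ?thesis by (rule sg_cancel)
qed

text \<open>The coefficients involve only dots below position \<open>n\<close>; an index map fixing
  these just moves the dot at which the polynomial is evaluated.\<close>

lemma horner_shift:
  assumes "polylist {..<n} G" "f m = m'" "\<And>k. k < n \<Longrightarrow> f k = k"
  shows "horner (G (\<lambda>k. Y (f k))) (Y (f m)) = horner (G Y) (Y m')"
proof -
  have "G (\<lambda>k. Y (f k)) = G Y"
    using assms by (intro polylist_cong[OF assms(1)]) auto
  then show ?thesis using assms by simp
qed

lemma d_e_assoc:
  "d (length a) * (e (a @ p # q # b) * x) = e (a @ q # p # b) * (d (length a) * x)"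
  by (simp only: mult.assoc[symmetric] d_e)

lemma polyfun_horner_var: "polylist S G \<Longrightarrow> polyfun (insert m S) (\<lambda>y. horner (G y) (y m))"
  using polylist_mono[of S G "insert m S"] by (intro polyfun_horner polyfun.var) auto

text \<open>Between two crossings, the first dot of the linear factor becomes \<open>- sg p\<close>
  times one crossing, while the second passes out and leaves a double crossing, which is 0. Thus
  \<open>F d e = 0\<close>, and the nilHecke relation gives \<open>F e = 0\<close>.\<close>

lemma double_strand:
  assumes F: "polyfun S F" "length a \<notin> S" "Suc (length a) \<notin> S"
    and 0: "F Y * (Y (Suc (length a)) - Y (Suc (Suc (length a)))) * e (a @ p # p # b) = 0"
  shows "F Y * e (a @ p # p # b) = 0"
proof -
  let ?n = "length a" and ?i = "a @ p # p # b"
  have Fd: "F Y * (d ?n * x) = d ?n * (F Y * x)" for x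
    using polyfun_d[OF F] by (simp only: mult.assoc[symmetric])
  have YF: "F Y * (Y k * x) = Y k * (F Y * x)" for k x
    using polyfun_Y[OF F(1)] by (simp only: mult.assoc[symmetric])
  have Yd: "Y (Suc ?n) * (d ?n * e ?i) = d ?n * (Y ?n * e ?i) - sg p * e ?i"
    using dY_same[of a p b] by (simp add: mult.assoc algebra_simps)
  have dYd: "d ?n * (Y (Suc ?n) * (d ?n * e ?i)) = - (sg p * (d ?n * e ?i))"
    using dd_same[of a p b] sg_comm[of p "d ?n"]
    unfolding Yd right_diff_distrib Y_e by (simp add: mult.assoc[symmetric])
  have Ydd: "Y (Suc (Suc ?n)) * (d ?n * (d ?n * e ?i)) = 0"
    using dd_same[of a p b] by (simp add: mult.assoc)
  have "d ?n * (F Y * (Y (Suc ?n) - Y (Suc (Suc ?n))) * e ?i) * d ?n = 0"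
    unfolding 0 by simp
  then have z: "F Y * (d ?n * (Y (Suc ?n) * (d ?n * e ?i))) - F Y * (d ?n * (Y (Suc (Suc ?n)) * (d ?n * e ?i))) = 0"
    unfolding Fd d_e by (simp add: mult.assoc algebra_simps)
  have dY2: "d ?n * (Y (Suc (Suc ?n)) * (d ?n * e ?i)) = 0"
    using Ydd d_Y_far[of "Suc (Suc ?n)" ?n] by (simp flip: mult.assoc)
  have "sg p * (F Y * (d ?n * e ?i)) = 0"
    using z sg_comm[of p "F Y"] unfolding dYd dY2 by (simp add: mult.assoc[symmetric])
  then have Fd0: "F Y * (d ?n * e ?i) = 0" by (rule sg_cancel)
  have "F Y * (sg p * e ?i) = F Y * (d ?n * e ?i) * Y ?n - Y (Suc ?n) * (F Y * (d ?n * e ?i))"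
    unfolding dY_same[symmetric] right_diff_distrib YF[symmetric] by (simp only: mult.assoc Y_e)
  then have "F Y * (sg p * e ?i) = 0" by (simp add: Fd0)
  then have "sg p * (F Y * e ?i) = 0"
    using sg_comm[of p "F Y"] by (simp add: mult.assoc[symmetric])
  then show ?thesis by (rule sg_cancel)
qed

text \<open>The second copy of the repeated colour crosses the next colour and then the far rest of
  the run, reaching a sequence covered by the hypothesis. The adjacent crossing costs a linear
  factor, which \<open>double_strand\<close> removes.\<close>

lemma double_descending_zero:
  assumes G: "polylist {..<length a} G"
    and 0: "\<And>b. horner (G Y) (Y (length a + Suc t)) * e (a @ descending c (Suc t) @ c # b) = 0"
  shows "horner (G Y) (Y (Suc (length a + Suc t))) * e (a @ (c + int (Suc t)) # descending c (Suc t) @ c # b) = 0"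
proof -
  let ?n = "length a" and ?p = "c + int (Suc t)" and ?q = "c + int t"
  let ?m = "Suc (?n + Suc t)"
  let ?F = "\<lambda>y. horner (G y) (y ?m)"
  let ?t = "transpose (length (a @ [?p])) (Suc (length (a @ [?p])))"
  have F: "polyfun (insert ?m {..<?n}) ?F"
    by (rule polyfun_horner_var[OF G])
  have "horner (G Y) (Y (?t ?m)) * e ((a @ [?p, ?q]) @ ?p # descending (c - 1) t @ b) = 0"
  proof (rule move_right[OF _ polyfun_horner_var[OF G]])
    show "\<forall>q\<in>set (descending (c - 1) t). \<bar>?p - q\<bar> \<ge> 2" by (auto simp: set_descending)
    show "horner (G (\<lambda>k. Y (if k = length (a @ [?p, ?q]) then length (a @ [?p, ?q]) + length (descending (c - 1) t)
             else if length (a @ [?p, ?q]) < k \<and> k \<le> length (a @ [?p, ?q]) + length (descending (c - 1) t)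
             then k - 1 else k)))
          (Y (if ?t ?m = length (a @ [?p, ?q]) then length (a @ [?p, ?q]) + length (descending (c - 1) t)
             else if length (a @ [?p, ?q]) < ?t ?m \<and> ?t ?m \<le> length (a @ [?p, ?q]) + length (descending (c - 1) t)
             then ?t ?m - 1 else ?t ?m))
          * e ((a @ [?p, ?q]) @ descending (c - 1) t @ ?p # b) = 0"
      using 0[of "?p # b"]
      by (subst horner_shift[OF G, where m' = "?n + Suc t"]) (auto simp: transpose_def descending_snoc)
  qed
  moreover have "G (\<lambda>k. Y (?t k)) = G Y"
    by (rule polylist_cong[OF G]) (auto simp: transpose_def)
  ultimately have "?F Y * (Y (length (a @ [?p])) - Y (Suc (length (a @ [?p])))) * e ((a @ [?p]) @ ?p # ?q # descending (c - 1) t @ b) = 0"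
    by (intro adj_swap[OF _ F]) simp_all
  then have "?F Y * e (a @ ?p # ?p # ?q # descending (c - 1) t @ b) = 0"
    by (intro double_strand[OF F]) simp_all
  then show ?thesis by (simp add: descending_snoc)
qed

text \<open>The braid relation expresses the idempotent through diagrams passing
  \<open>q c c\<close> and \<open>c c q\<close>. There the divided difference is taken at two
  neighbouring strands of colour \<open>c\<close>, where the nilHecke argument applies.\<close>

lemma braid_zero:
  assumes "\<bar>c - q\<bar> = 1" and G: "polylist {..<length a} G"
    and 1: "\<And>b. horner (G Y) (Y (length a)) * e (a @ c # b) = 0"
    and 2: "\<And>b. horner (G Y) (Y (Suc (length a))) * e (a @ q # c # b) = 0"
  shows "horner (diff_quotient (Y (length a)) (G Y)) (Y (Suc (Suc (length a)))) * e (a @ c # q # c # b) = 0"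
proof -
  let ?n = "length a"
  let ?F = "\<lambda>y. horner (diff_quotient (y ?n) (G y)) (y (Suc (Suc ?n)))"
  let ?i = "a @ c # q # c # b"
  have F: "polyfun UNIV ?F"
    using polylist_mono[OF G subset_UNIV] by (intro polyfun_horner polylist_diff_quotient polyfun.var) auto
  have cq: "c \<noteq> q" "q \<noteq> c" using assms(1) by auto
  have G': "G (\<lambda>k. Y (transpose m (Suc m) k)) = G Y" if "?n \<le> m" for m
    using that by (intro polylist_cong[OF G]) (auto simp: transpose_def)
  have "?F Y * d ?n * e (a @ q # c # c # b) = 0"
    using divided_difference_zero[of "{..<?n}" G "a @ [q]" c b] G 2[of "c # b"] cq
    by (subst polyfun_swap'[OF _ F]) (simp_all add: G' mult.assoc)
  then have "?F Y * d ?n * e (a @ q # c # c # b) * d (Suc ?n) * d ?n = 0" by simp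
  then have t1: "?F Y * (d ?n * d (Suc ?n) * d ?n * e ?i) = 0"
    using d_e_assoc[of "a @ [q]" c c b] by (simp add: mult.assoc d_e[of a c q "c # b"])
  have "?F Y * d (length (a @ [c])) * e ((a @ [c]) @ c # q # b) = 0"
    using divided_difference_zero[of "{..<?n}" G a c "q # b"] G 1[of "c # q # b"] cq
    by (subst polyfun_swap'[OF _ F]) (simp_all add: G' mult.assoc)
  then have "?F Y * d (Suc ?n) * e (a @ c # c # q # b) * d ?n * d (Suc ?n) = 0" by simp
  then have t2: "?F Y * (d (Suc ?n) * d ?n * d (Suc ?n) * e ?i) = 0"
    using d_e[of "a @ [c]" q c b] by (simp add: mult.assoc d_e_assoc[of a c c "q # b"])
  show ?thesis
    using t1 t2 by (subst braid[OF assms(1), symmetric]) (simp add: right_diff_distrib)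
qed

text \<open>Since \<open>F\<close> does not involve the three strands, it commutes with both
  crossings of the braid relation and reaches the idempotents of \<open>q p p\<close> and
  \<open>p p q\<close>.\<close>

lemma braid_inert:
  assumes "\<bar>p - q\<bar> = 1" and F: "polyfun S F" "length a \<notin> S" "Suc (length a) \<notin> S" "Suc (Suc (length a)) \<notin> S"
    and 1: "F Y * e (a @ q # p # p # b) = 0"
    and 2: "F Y * e (a @ p # p # q # b) = 0"
  shows "F Y * e (a @ p # q # p # b) = 0"
proof -
  let ?n = "length a" and ?i = "a @ p # q # p # b"
  have Fd: "F Y * (d ?n * x) = d ?n * (F Y * x)" "F Y * (d (Suc ?n) * x) = d (Suc ?n) * (F Y * x)" for x
    using polyfun_d[OF F(1-3)] polyfun_d[OF F(1,3,4)] by (simp_all only: mult.assoc[symmetric])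
  have "d ?n * (d (Suc ?n) * (F Y * e (a @ q # p # p # b) * d ?n)) = 0"
    using 1 by simp
  then have t1: "F Y * (d ?n * d (Suc ?n) * d ?n * e ?i) = 0"
    using d_e[of a p q "p # b"] by (simp add: mult.assoc Fd)
  have "d (Suc ?n) * (d ?n * (F Y * e (a @ p # p # q # b) * d (Suc ?n))) = 0"
    using 2 by simp
  then have t2: "F Y * (d (Suc ?n) * d ?n * d (Suc ?n) * e ?i) = 0"
    using d_e[of "a @ [p]" q p b] by (simp add: mult.assoc Fd)
  show ?thesis
    using t1 t2 by (subst braid[OF assms(1), symmetric]) (simp add: right_diff_distrib)
qed

text \<open>With nothing in front of the run the series is the power \<open>z ^ U c\<close>. Its
  \<open>W c\<close> part comes from \<open>c\<close> placed at the front, its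
  \<open>U (c + 1)\<close> part from the strand \<open>c + 1\<close>.\<close>

lemma descending_zero_Nil:
  assumes IH: "\<And>s'. s' < s \<Longrightarrow> Y s' ^ U (c + 1) * e (descending (c + 1) s' @ (c + 1) # c # b) = 0"
  shows "Y s ^ U c * e (descending c s @ c # b) = 0"
proof (cases s)
  case 0
  then show ?thesis
    using cyc[of c b] by (simp add: U[of c] add.commute[of "W c"] power_add mult.assoc)
next
  case (Suc t)
  let ?i = "descending (c + 1) t @ (c + 1) # c # b"
  have pw: "polyfun UNIV (\<lambda>y::nat\<Rightarrow>'r. y k ^ n)" for k n
    by (induction n) (simp_all add: polyfun.one polyfun.mult polyfun.var)
  \<comment> \<open>With \<open>c\<close> in front the power vanishes by \<open>cyc\<close>; the
    strand then moves past colours that are at least \<open>c + 2\<close>.\<close>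
  have "Y t ^ W c * e (descending (c + 1) t @ c # (c + 1) # b) = 0"
    using cyc[of c "descending (c + 1) t @ (c + 1) # b"]
      move_left_pow[of "descending (c + 1) t" c "[]" "W c" "(c + 1) # b"]
    by (auto simp: set_descending)
  then have eq: "Y s ^ W c * Y t * e ?i = Y s ^ W c * Y s * e ?i"
    using adj_swap[of "c + 1" c UNIV "\<lambda>y. y s ^ W c" "descending (c + 1) t" b] pw Suc
    by (simp add: algebra_simps)
  have comm: "Y t * Y s ^ n = Y s ^ n * Y t" for n
    using polyfun_Y[OF pw] by metis
  \<comment> \<open>The factor \<open>Y s ^ W c\<close> lets every further \<open>Y s\<close> be
    replaced by \<open>Y t\<close>, the dot of the strand \<open>c + 1\<close>, to which the
    hypothesis applies.\<close>
  have "Y s ^ W c * Y s ^ n * e ?i = Y s ^ W c * Y t ^ n * e ?i" for n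
  proof (induction n)
    case (Suc n)
    have 1: "Y s ^ W c * Y s ^ Suc n = Y s ^ n * (Y s ^ W c * Y s)"
      unfolding power_Suc2[symmetric] power_add[symmetric] by (simp add: add.commute)
    have "Y s ^ n * (Y s ^ W c * Y t) = Y t * Y s ^ (n + W c)"
      unfolding comm by (simp only: power_add mult.assoc)
    then have 2: "Y s ^ n * (Y s ^ W c * Y t) = Y t * (Y s ^ W c * Y s ^ n)"
      by (simp only: add.commute[of n] power_add)
    have "Y s ^ W c * Y s ^ Suc n * e ?i = Y s ^ n * (Y s ^ W c * Y t * e ?i)"
      unfolding 1 eq by (simp only: mult.assoc)
    also have "\<dots> = Y t * (Y s ^ W c * Y s ^ n * e ?i)"
      using 2 by (simp only: mult.assoc[symmetric])
    also have "\<dots> = Y s ^ W c * Y t ^ Suc n * e ?i"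
      unfolding Suc by (simp add: mult.assoc[symmetric] comm)
    finally show ?case .
  qed simp
  then have "Y s ^ U c * e ?i = 0"
    using IH[of t] Suc by (simp add: U[of c] power_add mult.assoc)
  then show ?thesis using Suc descending_Suc_snoc[of c t] by simp
qed

text \<open>
  The last colour \<open>p\<close> of \<open>k\<close> is compared with the run \<open>c + s, ..., c\<close> behind it: a colour far from the run
  moves to its right end, \<open>c + s + 1\<close> lengthens the run, \<open>c - 1\<close> moves up to the strand \<open>c\<close>, and any other
  colour forms a pattern \<open>p p\<close> or \<open>p (p + 1) p\<close> to which the nilHecke or the braid relation applies.
\<close>

lemma descending_zero_step:
  assumes IH: "\<And>k s c b. length k + s < N \<Longrightarrow>
      horner (theta U c k Y) (Y (length k + s)) * e (k @ descending c s @ c # b) = 0"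
  shows "length k + s = N \<Longrightarrow> horner (theta U c k Y) (Y (length k + s)) * e (k @ descending c s @ c # b) = 0"
proof (induction k arbitrary: s b rule: rev_induct)
  case Nil
  have "Y s' ^ U (c + 1) * e (descending (c + 1) s' @ (c + 1) # c # b) = 0" if "s' < s" for s'
    using IH[of "[]" s' "c + 1" "c # b"] that Nil by (simp add: horner_monomial)
  then show ?case by (simp add: horner_monomial descending_zero_Nil)
next
  case (snoc p k)
  let ?n = "length k"
  have N: "N = Suc (?n + s)" using snoc.prems by simp
  have G: "polylist {..<?n} (theta U c k :: (nat \<Rightarrow> 'r) \<Rightarrow> 'r list)"
    by (rule polylist_theta)
  \<comment> \<open>Colours above \<open>c\<close> leave the series unchanged, so \<open>w\<close>
    counts as part of the sequence; its length \<open>s\<close> keeps the total below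
    \<open>N\<close>.\<close>
  have above: "horner (theta U c k Y) (Y (?n + length w)) * e (k @ w @ c # b) = 0"
    if "\<forall>x\<in>set w. c < x" "length w = s" for w b
    using IH[of "k @ w" 0 c b] that theta_append_above[of w c U k Y] by (simp add: N)
  have descending: "horner (theta U c k Y) (Y (?n + s)) * e (k @ descending c s @ c # b) = 0" for b
    using IH[of k s c b] by (simp add: N)
  have snoc_far: "theta U c (k @ [p]) = (theta U c k :: (nat \<Rightarrow> 'r) \<Rightarrow> 'r list)" if "p \<noteq> c" "p \<noteq> c - 1"
    using that by (intro ext) (simp add: theta_snoc)
  consider "p \<le> c - 2 \<or> p \<ge> c + int s + 2" | "p = c - 1" | "p = c" |
     t where "p = c + int (Suc t)" "Suc t < s" | "p = c + int s" "s > 0" | "p = c + int s + 1"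
  proof -
    have "\<exists>t. p = c + int (Suc t) \<and> Suc t < s" if "c < p" "p < c + int s"
      using that by (intro exI[of _ "nat (p - c - 1)"]) auto
    then show ?thesis using that by fastforce
  qed
  then show ?case
  proof cases
    case 1
    then have p: "theta U c (k @ [p]) = (theta U c k :: (nat \<Rightarrow> 'r) \<Rightarrow> 'r list)"
      by (intro snoc_far) auto
    have "horner (theta U c k Y) (Y (Suc (?n + s))) * e (k @ p # (descending c s @ [c]) @ b) = 0"
    proof (rule move_right[OF _ polyfun_horner_var[OF G]])
      show "\<forall>q\<in>set (descending c s @ [c]). \<bar>p - q\<bar> \<ge> 2"
        using 1 by (auto simp: set_descending)
    qed (subst horner_shift[OF G, where m' = "?n + s"], use descending in auto)
    then show ?thesis by (simp add: p)
  next
    case 2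
    have "horner (theta U c k Y) (Y (Suc (?n + s))) * (Y (length (k @ descending c s)) - Y (Suc (length (k @ descending c s))))
        * e ((k @ descending c s) @ p # c # b) = 0"
    proof (rule adj_swap[OF _ polyfun_horner_var[OF G]])
      show "\<bar>p - c\<bar> = 1" using 2 by simp
    qed (subst horner_shift[OF G, where m' = "?n + s"], use descending in \<open>auto simp: transpose_def\<close>)
    \<comment> \<open>The factor left by the adjacent crossing is, up to sign, the linear factor
      that a strand of colour \<open>c - 1\<close> contributes to the series.\<close>
    moreover have "horner (linear_mult (Y (?n + s)) 0 (theta U c k Y)) (Y (Suc (?n + s)))
        = - (horner (theta U c k Y) (Y (Suc (?n + s))) * (Y (?n + s) - Y (Suc (?n + s))))"
      unfolding horner_linear_mult[OF Y_Y] using polyfun_Y[OF polyfun_horner_var[OF G]] by (simp add: algebra_simps)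
    ultimately have 0: "horner (linear_mult (Y (?n + s)) 0 (theta U c k Y)) (Y (Suc (?n + s))) * e ((k @ descending c s) @ p # c # b) = 0"
      by simp
    have F: "polyfun UNIV (\<lambda>y :: nat \<Rightarrow> 'r. horner (linear_mult (y ?n) 0 (theta U c k y)) (y (Suc (?n + s))))"
      using polylist_mono[OF G subset_UNIV] by (intro polyfun_horner polylist_linear_mult polyfun.var polyfun.zero) auto
    have sh: "theta U c k (\<lambda>l. Y (if l = ?n then ?n + length (descending c s)
            else if ?n < l \<and> l \<le> ?n + length (descending c s) then l - 1 else l)) = theta U c k Y"
      by (rule polylist_cong[OF G]) auto
    have "horner (linear_mult (Y ?n) 0 (theta U c k Y)) (Y (Suc (?n + s))) * e (k @ p # descending c s @ c # b) = 0"
      by (rule move_right[OF _ F]) (use 0 2 in \<open>auto simp: set_descending sh\<close>)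
    then show ?thesis using 2 by (simp add: theta_snoc)
  next
    case 3
    show ?thesis
    proof (cases s)
      case 0
      then show ?thesis
        using divided_difference_zero[OF G, of k c b] descending[of "c # b"] 3 by (simp add: theta_snoc)
    next
      case (Suc t)
      \<comment> \<open>The strand \<open>p = c\<close> passes \<open>c + s\<close>, ...,
        \<open>c + 2\<close> and stops before \<open>c + 1\<close>, forming the pattern
        \<open>c (c + 1) c\<close>.\<close>
      let ?a = "k @ descending (c + 1) t"
      have G': "polylist {..<length ?a} (theta U c k :: (nat \<Rightarrow> 'r) \<Rightarrow> 'r list)"
        using polylist_mono[OF G] by fastforce
      have 0: "horner (diff_quotient (Y (length ?a)) (theta U c k Y)) (Y (Suc (Suc (length ?a)))) * e (?a @ c # (c + 1) # c # b) = 0"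
      proof (rule braid_zero[OF _ G'])
        show "horner (theta U c k Y) (Y (length ?a)) * e (?a @ c # b') = 0" for b'
          using IH[of ?a 0 c b'] theta_append_above[of "descending (c + 1) t" c U k Y] N Suc
          by (simp add: set_descending)
        show "horner (theta U c k Y) (Y (Suc (length ?a))) * e (?a @ (c + 1) # c # b') = 0" for b'
          using descending[of b'] Suc descending_Suc_snoc[of c t] by (simp del: descending.simps)
      qed simp
      have F: "polyfun UNIV (\<lambda>y :: nat \<Rightarrow> 'r. horner (diff_quotient (y ?n) (theta U c k y)) (y (Suc (?n + s))))"
        using polylist_mono[OF G subset_UNIV] by (intro polyfun_horner polylist_diff_quotient polyfun.var) auto
      have sh: "theta U c k (\<lambda>l. Y (if l = ?n then ?n + length (descending (c + 1) t)
            else if ?n < l \<and> l \<le> ?n + length (descending (c + 1) t) then l - 1 else l)) = theta U c k Y"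
        by (rule polylist_cong[OF G]) auto
      have "horner (diff_quotient (Y ?n) (theta U c k Y)) (Y (Suc (?n + s))) * e (k @ p # descending (c + 1) t @ (c + 1) # c # b) = 0"
        by (rule move_right[OF _ F]) (use 0 3 Suc in \<open>auto simp: set_descending sh\<close>)
      then show ?thesis using 3 Suc descending_Suc_snoc[of c t] by (simp add: theta_snoc del: descending.simps)
    qed
  next
    case 4
    \<comment> \<open>\<open>m\<close> counts the colours of the run above \<open>p + 1\<close>;
      they are far from \<open>p\<close>.\<close>
    define m where "m = s - Suc (Suc t)"
    have s: "s = m + Suc (Suc t)" using 4 by (simp add: m_def)
    let ?u = "descending (p + 1) m" and ?F = "\<lambda>y :: nat \<Rightarrow> 'r. horner (theta U c k y) (y (Suc (?n + s)))"
    let ?a = "k @ ?u"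
    have ch: "descending c s = ?u @ (p + 1) # descending c (Suc t)"
      unfolding s descending_add using 4 by (simp add: algebra_simps)
    have G': "polylist {..<length (?a @ [p + 1])} (theta U c k :: (nat \<Rightarrow> 'r) \<Rightarrow> 'r list)"
      using polylist_mono[OF G] by fastforce
    have "?F Y * e (?a @ p # (p + 1) # p # descending c t @ c # b) = 0"
    proof (rule braid_inert[OF _ polyfun_horner_var[OF G]])
      have "horner (theta U c k Y) (Y (length (?a @ [p + 1]) + Suc t)) * e ((?a @ [p + 1]) @ descending c (Suc t) @ c # b') = 0" for b'
        using descending[of b'] unfolding ch by (simp add: s add.assoc)
      from double_descending_zero[OF G' this, of b] show "?F Y * e (?a @ (p + 1) # p # p # descending c t @ c # b) = 0"
        using 4 by (simp add: s add.assoc)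
      let ?a' = "?a @ [p, p]"
      \<comment> \<open>The strand \<open>p + 1\<close> leaves the run to the right, past colours at
        most \<open>p - 1\<close>; all colours added between \<open>k\<close> and \<open>c\<close>
        then lie above \<open>c\<close>, so \<open>above\<close> applies.\<close>
      have "?F Y * e (?a' @ (p + 1) # (descending c t @ [c]) @ b) = 0"
      proof (rule move_right[OF _ polyfun_horner_var[OF G]])
        show "\<forall>q\<in>set (descending c t @ [c]). \<bar>p + 1 - q\<bar> \<ge> 2"
          using 4 by (auto simp: set_descending)
        have "horner (theta U c k Y) (Y (?n + s)) * e (k @ (?u @ [p, p] @ descending c t) @ c # (p + 1) # b) = 0"
        proof -
          have "\<forall>x\<in>set (?u @ [p, p] @ descending c t). c < x" "length (?u @ [p, p] @ descending c t) = s"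
            using 4 by (auto simp: s set_descending)
          from above[OF this] show ?thesis by (simp add: s)
        qed
        then show "horner (theta U c k (\<lambda>l. Y (if l = length ?a' then length ?a' + length (descending c t @ [c])
            else if length ?a' < l \<and> l \<le> length ?a' + length (descending c t @ [c]) then l - 1 else l)))
          (Y (if Suc (?n + s) = length ?a' then length ?a' + length (descending c t @ [c])
            else if length ?a' < Suc (?n + s) \<and> Suc (?n + s) \<le> length ?a' + length (descending c t @ [c])
            then Suc (?n + s) - 1 else Suc (?n + s)))
          * e (?a' @ (descending c t @ [c]) @ (p + 1) # b) = 0"
          by (subst horner_shift[OF G, where m' = "?n + s"]) (auto simp: s)
      qed
      then show "?F Y * e (?a @ p # p # (p + 1) # descending c t @ c # b) = 0" by simp
    qed (auto simp: s)
    then have 0: "?F Y * e (k @ ?u @ p # (p + 1) # p # descending c t @ c # b) = 0" by simp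
    have "?F Y * e (k @ p # ?u @ (p + 1) # p # descending c t @ c # b) = 0"
    proof (rule move_right[OF _ polyfun_horner_var[OF G]])
      show "\<forall>q\<in>set ?u. \<bar>p - q\<bar> \<ge> 2" by (auto simp: set_descending)
    qed (subst horner_shift[OF G, where m' = "Suc (?n + s)"], use 0 in \<open>auto simp: s\<close>)
    then show ?thesis using 4 snoc_far by (simp add: ch)
  next
    case 5
    then obtain t where t: "s = Suc t" by (cases s) auto
    show ?thesis
      using double_descending_zero[OF G, of t c b] descending snoc_far 5 by (simp add: t)
  next
    case 6
    \<comment> \<open>The strand passes from \<open>k\<close> to the run and the total
      \<open>N\<close> is unchanged, so the inner induction on \<open>k\<close> applies.\<close>
    show ?thesis
      using snoc.IH[of "Suc s" b] N snoc_far 6 by (simp add: algebra_simps)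
  qed
qed

text \<open>Strong induction on the number of strands before the annihilated one; the run is empty
  in the case wanted.\<close>

lemma theta_zero: "horner (theta U c k Y) (Y (length k)) * e (k @ c # b) = 0"
proof -
  have "horner (theta U c k Y) (Y (length k + s)) * e (k @ descending c s @ c # b) = 0" for k s c b
    by (induction "length k + s" arbitrary: k s c b rule: less_induct) (rule descending_zero_step; simp)
  from this[of c k 0 b] show ?thesis by simp
qed

end


section \<open>Reflecting the colours\<close>

text \<open>\<open>V c\<close> stands for the sum of the weights \<open>W j\<close> with
  \<open>j \<le> c\<close>, the mirror image of \<open>U\<close>.\<close>

locale klr_nilpotent = klr_relations +
  fixes V :: "int \<Rightarrow> nat"
  assumes V: "V c = W c + V (c - 1)"
begin

text \<open>The relations see colours only through equality, distance and signs, so they survive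
  negation of all colours. This makes the annihilation result available for the reflected
  series.\<close>

sublocale mirror: klr_relations "\<lambda>i. e (map uminus i)" Y d "\<lambda>c. W (- c)" "\<lambda>c. V (- c)" "\<lambda>c. sg (- c)"
proof unfold_locales
  fix a b :: "int list" and p q :: int
  let ?a = "map uminus a" and ?b = "map uminus b"
  show "d (length a) * e (map uminus (a @ p # q # b)) = e (map uminus (a @ q # p # b)) * d (length a)"
    using d_e[of ?a] by simp
  show "d (length a) * d (length a) * e (map uminus (a @ p # p # b)) = 0"
    using dd_same[of ?a] by simp
  show "d (length a) * d (length a) * e (map uminus (a @ p # q # b)) = e (map uminus (a @ p # q # b))"
    if "\<bar>p - q\<bar> \<ge> 2"
    using that dd_far[of "- p" "- q" ?a] by simp
  show "d (length a) * d (length a) * e (map uminus (a @ p # q # b)) =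
      sg (- p) * ((Y (length a) - Y (Suc (length a))) * e (map uminus (a @ p # q # b)))"
    if "\<bar>p - q\<bar> = 1"
    using that dd_adj[of "- p" "- q" ?a] by simp
  show "Y (length a) * d (length a) * e (map uminus (a @ p # q # b)) =
      d (length a) * Y (Suc (length a)) * e (map uminus (a @ p # q # b))" if "p \<noteq> q"
    using that Y_d1[of "- p" "- q" ?a] by simp
  show "Y (Suc (length a)) * d (length a) * e (map uminus (a @ p # q # b)) =
      d (length a) * Y (length a) * e (map uminus (a @ p # q # b))" if "p \<noteq> q"
    using that Y_d2[of "- p" "- q" ?a] by simp
  show "d (length a) * Y (length a) * e (map uminus (a @ p # p # b)) -
      Y (Suc (length a)) * d (length a) * e (map uminus (a @ p # p # b)) =
      sg (- p) * e (map uminus (a @ p # p # b))"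
    using dY_same[of ?a] by simp
  show "d (length a) * d (Suc (length a)) * d (length a) * e (map uminus (a @ p # q # p # b)) -
      d (Suc (length a)) * d (length a) * d (Suc (length a)) * e (map uminus (a @ p # q # p # b)) =
      e (map uminus (a @ p # q # p # b))" if "\<bar>p - q\<bar> = 1"
    using that braid[of "- p" "- q" ?a] by simp
  show "V (- c) = W (- c) + V (- (c + 1))" for c
    using V[of "- c"] by simp
qed (use sg ee Y_Y Y_e d_Y_far cyc in auto)

text \<open>Negation takes \<open>c - 1\<close> to \<open>1 - c\<close> and \<open>c\<close> to
  \<open>- c\<close>, so a strand of either colour divides one series and multiplies the other. The
  discarded remainder is the series at the new dot, which \<open>theta_zero\<close> or its mirror
  kills.\<close>

lemma theta_product:
  "horner (theta U c k Y) (Y n) * horner (theta (\<lambda>c. V (- c)) (1 - c) (map uminus k) Y) (Y n) * e (k @ b)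
   = Y n ^ (U c + V (c - 1)) * e (k @ b)"
proof (induction k arbitrary: b rule: rev_induct)
  case Nil
  then show ?case by (simp add: horner_monomial power_add)
next
  case (snoc p k)
  let ?m = "length k"
  let ?P = "\<lambda>y :: nat \<Rightarrow> 'a. theta U c k y"
    and ?Q = "\<lambda>y :: nat \<Rightarrow> 'a. theta (\<lambda>c. V (- c)) (1 - c) (map uminus k) y"
  let ?y = "Y ?m" and ?z = "Y n" and ?i = "k @ p # b"
  have comm: "horner (?P Y) (Y l) * horner (?Q Y) (Y l') = horner (?Q Y) (Y l') * horner (?P Y) (Y l)" for l l'
    by (rule polyfun_polyfun[OF polyfun_horner_var[OF polylist_theta] polyfun_horner_var[OF polylist_theta]])
  have comm_Y: "horner (?Q Y) (Y l') * Y l = Y l * horner (?Q Y) (Y l')"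
       "horner (?P Y) (Y l') * Y l = Y l * horner (?P Y) (Y l')" for l l'
    by (rule polyfun_Y[OF polyfun_horner_var[OF polylist_theta]])+
  have dP: "polyfun UNIV (\<lambda>y :: nat \<Rightarrow> 'a. horner (diff_quotient (y ?m) (?P y)) (y n))"
    by (intro polyfun_horner polylist_diff_quotient polyfun.var polylist_mono[OF polylist_theta]) auto
  have IH: "horner (?P Y) ?z * horner (?Q Y) ?z * e ?i = ?z ^ (U c + V (c - 1)) * e ?i"
    using snoc.IH[of "p # b"] .
  consider "p = c" | "p = c - 1" | "p \<noteq> c" "p \<noteq> c - 1" by blast
  then show ?case
  proof cases
    case 1
    have "horner (diff_quotient ?y (?P Y)) ?z * ((?z - ?y) * horner (?Q Y) ?z) = (horner (?P Y) ?z - horner (?P Y) ?y) * horner (?Q Y) ?z"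
      using polyfun_Y[OF dP] unfolding horner_diff_quotient[OF Y_Y, symmetric]
      by (simp add: left_diff_distrib right_diff_distrib mult.assoc[symmetric])
    also have "\<dots> = horner (?P Y) ?z * horner (?Q Y) ?z - horner (?Q Y) ?z * horner (?P Y) ?y"
      by (simp add: left_diff_distrib comm)
    finally show ?thesis
      using theta_zero[of c k b] IH 1 by (simp add: theta_snoc horner_linear_mult[OF Y_Y] left_diff_distrib mult.assoc)
  next
    case 2
    have "(?z - ?y) * horner (?P Y) ?z * horner (diff_quotient ?y (?Q Y)) ?z = horner (?P Y) ?z * ((?z - ?y) * horner (diff_quotient ?y (?Q Y)) ?z)"
      by (simp add: left_diff_distrib right_diff_distrib comm_Y flip: mult.assoc)
    also have "\<dots> = horner (?P Y) ?z * (horner (?Q Y) ?z - horner (?Q Y) ?y)"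
      by (simp only: horner_diff_quotient[OF Y_Y])
    finally show ?thesis
      using mirror.theta_zero[of "1 - c" "map uminus k" "map uminus b"] IH 2
      by (simp add: theta_snoc horner_linear_mult[OF Y_Y] left_diff_distrib right_diff_distrib mult.assoc comp_def)
  next
    case 3
    then show ?thesis using IH by (simp add: theta_snoc)
  qed
qed

text \<open>The product identity is evaluated at the dot of the strand \<open>c\<close>, where
  \<open>theta_zero\<close> kills the factor belonging to \<open>U\<close>.\<close>

theorem Y_nilpotent: "Y (length k) ^ (U c + V (c - 1)) * e (k @ c # b) = 0"
proof -
  have "horner (theta U c k Y) (Y (length k)) * horner (theta (\<lambda>c. V (- c)) (1 - c) (map uminus k) Y) (Y (length k))
      = horner (theta (\<lambda>c. V (- c)) (1 - c) (map uminus k) Y) (Y (length k)) * horner (theta U c k Y) (Y (length k))"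
    by (rule polyfun_polyfun[OF polyfun_horner_var[OF polylist_theta] polyfun_horner_var[OF polylist_theta]])
  then show ?thesis
    using theta_product[of c k "length k" "c # b"] theta_zero[of c k b]
    by (simp add: mult.assoc)
qed

end


section \<open>Quotients by two-sided ideals\<close>

definition two_sided :: "'r::ring_1 set \<Rightarrow> bool" where
  "two_sided I \<longleftrightarrow> 0 \<in> I \<and> (\<forall>a\<in>I. \<forall>b\<in>I. a - b \<in> I) \<and> (\<forall>a\<in>I. \<forall>x. x * a \<in> I \<and> a * x \<in> I)"

lemma two_sided_D:
  assumes "two_sided I"
  shows "0 \<in> I" "a \<in> I \<Longrightarrow> b \<in> I \<Longrightarrow> a - b \<in> I" "a \<in> I \<Longrightarrow> - a \<in> I"
    "a \<in> I \<Longrightarrow> b \<in> I \<Longrightarrow> a + b \<in> I" "a \<in> I \<Longrightarrow> x * a \<in> I" "a \<in> I \<Longrightarrow> a * x \<in> I"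
proof -
  show *: "0 \<in> I" "a \<in> I \<Longrightarrow> b \<in> I \<Longrightarrow> a - b \<in> I" "a \<in> I \<Longrightarrow> x * a \<in> I" "a \<in> I \<Longrightarrow> a * x \<in> I"
    for a b using assms by (auto simp: two_sided_def)
  show m: "a \<in> I \<Longrightarrow> - a \<in> I" for a using *(2)[OF *(1)] by fastforce
  show "a \<in> I \<Longrightarrow> b \<in> I \<Longrightarrow> a + b \<in> I" using *(2)[of a "- b"] m by simp
qed

lemma two_sided_cong:
  assumes "two_sided I" "a - b \<in> I"
  shows "- a - - b \<in> I"
    "a' - b' \<in> I \<Longrightarrow> a + a' - (b + b') \<in> I"
    "a' - b' \<in> I \<Longrightarrow> a - a' - (b - b') \<in> I"
    "a' - b' \<in> I \<Longrightarrow> a * a' - b * b' \<in> I"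
proof -
  have "- a - - b = - (a - b)" "a + a' - (b + b') = (a - b) + (a' - b')"
    "a - a' - (b - b') = (a - b) - (a' - b')" "a * a' - b * b' = (a - b) * a' + b * (a' - b')"
    by (simp_all add: algebra_simps)
  with two_sided_D[OF assms(1)] assms(2)
  show "- a - - b \<in> I"
    "a' - b' \<in> I \<Longrightarrow> a + a' - (b + b') \<in> I"
    "a' - b' \<in> I \<Longrightarrow> a - a' - (b - b') \<in> I"
    "a' - b' \<in> I \<Longrightarrow> a * a' - b * b' \<in> I"
    by metis+
qed

text \<open>
  The product of the quotients by all two-sided ideals of \<open>'r\<close>: a single type into which every such quotient
  embeds, so that computations modulo an ideal depending on parameters become equations in a ring.
\<close>

quotient_type (overloaded) 'r all_quotients = "'r::ring_1 set \<Rightarrow> 'r" / "\<lambda>f g. \<forall>I. two_sided I \<longrightarrow> f I - g I \<in> I"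
proof (rule equivpI)
  show "reflp (\<lambda>f g :: 'r set \<Rightarrow> 'r. \<forall>I. two_sided I \<longrightarrow> f I - g I \<in> I)"
    by (auto intro!: reflpI two_sided_D(1))
  show "symp (\<lambda>f g :: 'r set \<Rightarrow> 'r. \<forall>I. two_sided I \<longrightarrow> f I - g I \<in> I)"
    using two_sided_D(3) by (fastforce intro!: sympI)
  show "transp (\<lambda>f g :: 'r set \<Rightarrow> 'r. \<forall>I. two_sided I \<longrightarrow> f I - g I \<in> I)"
  proof (rule transpI, intro allI impI)
    fix f g h :: "'r set \<Rightarrow> 'r" and I :: "'r set"
    assume "\<forall>I. two_sided I \<longrightarrow> f I - g I \<in> I" "\<forall>I. two_sided I \<longrightarrow> g I - h I \<in> I" "two_sided I"
    then show "f I - h I \<in> I"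
      using two_sided_D(4)[of I "f I - g I" "g I - h I"] by simp
  qed
qed

instantiation all_quotients :: (ring_1) ring_1
begin

lift_definition zero_all_quotients :: "'a all_quotients" is "\<lambda>_. 0" .
lift_definition one_all_quotients :: "'a all_quotients" is "\<lambda>_. 1" .
lift_definition uminus_all_quotients :: "'a all_quotients \<Rightarrow> 'a all_quotients" is "\<lambda>f I. - f I"
  by (blast intro: two_sided_cong)
lift_definition plus_all_quotients :: "'a all_quotients \<Rightarrow> 'a all_quotients \<Rightarrow> 'a all_quotients"
  is "\<lambda>f g I. f I + g I"
  by (blast intro: two_sided_cong)
lift_definition minus_all_quotients :: "'a all_quotients \<Rightarrow> 'a all_quotients \<Rightarrow> 'a all_quotients"
  is "\<lambda>f g I. f I - g I"
  by (blast intro: two_sided_cong)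
lift_definition times_all_quotients :: "'a all_quotients \<Rightarrow> 'a all_quotients \<Rightarrow> 'a all_quotients"
  is "\<lambda>f g I. f I * g I"
  by (blast intro: two_sided_cong)

instance
proof
  \<comment> \<open>The component at the zero ideal is the ring itself and separates 0 from
    1.\<close>
  show "(0 :: 'a all_quotients) \<noteq> 1"
    by transfer (auto intro!: exI[of _ "{0}"] simp: two_sided_def)
qed (transfer, simp add: algebra_simps two_sided_D(1))+

end

text \<open>The embedding of the factor at \<open>I\<close>; it is not unital.\<close>

lift_definition quotient_proj :: "'r::ring_1 set \<Rightarrow> 'r \<Rightarrow> 'r all_quotients"
  is "\<lambda>I a J. if J = I then a else 0" .

lemma quotient_proj_simps:
  "quotient_proj I (a * b) = quotient_proj I a * quotient_proj I b"
  "quotient_proj I (a + b) = quotient_proj I a + quotient_proj I b"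
  "quotient_proj I (a - b) = quotient_proj I a - quotient_proj I b"
  "quotient_proj I 0 = 0"
  by (transfer, simp add: two_sided_D(1))+

text \<open>All components away from \<open>I\<close> vanish by construction, so only the one at
  \<open>I\<close> is tested.\<close>

lemma quotient_proj_eq_0_iff: "two_sided I \<Longrightarrow> quotient_proj I a = 0 \<longleftrightarrow> a \<in> I"
  by transfer (auto simp: two_sided_D(1))


section \<open>Cyclotomic quotients\<close>

lemma two_sidedI:
  assumes "0 \<in> I" "\<And>a b. a \<in> I \<Longrightarrow> b \<in> I \<Longrightarrow> a + b \<in> I"
    "\<And>a x. a \<in> I \<Longrightarrow> x * a \<in> I" "\<And>a x. a \<in> I \<Longrightarrow> a * x \<in> I"
  shows "two_sided I"
proof -
  have "a - b \<in> I" if "a \<in> I" "b \<in> I" for a b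
    using assms(2)[OF that(1) assms(3)[OF that(2), of "- 1"]] by simp
  with assms show ?thesis by (auto simp: two_sided_def)
qed

text \<open>
  A retraction of the free algebra on all letters onto the one on \<open>G\<close>, killing the other letters; it extends
  ideals of the latter to ideals of the former.
\<close>

definition restrict_letters :: "'a set \<Rightarrow> ('a word \<Rightarrow>\<^sub>0 'k::field) \<Rightarrow> 'a word \<Rightarrow>\<^sub>0 'k" where
  "restrict_letters G = Poly_Mapping.mapp (\<lambda>w c. if set (letters w) \<subseteq> G then c else 0)"

lemma lookup_restrict_letters:
  "Poly_Mapping.lookup (restrict_letters G f) w = (if set (letters w) \<subseteq> G then Poly_Mapping.lookup f w else 0)"
  by (auto simp: restrict_letters_def mapp.rep_eq in_keys_iff)

lemma restrict_letters_add: "restrict_letters G (f + g) = restrict_letters G f + restrict_letters G g"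
  by (rule poly_mapping_eqI) (simp add: lookup_restrict_letters lookup_add)

lemma restrict_letters_closed: "restrict_letters G f \<in> carrier (free_algebra G)"
  by (auto simp: free_algebra_def in_keys_iff lookup_restrict_letters split: if_splits)

lemma restrict_letters_ident: "f \<in> carrier (free_algebra G) \<Longrightarrow> restrict_letters G f = f"
  by (rule poly_mapping_eqI) (auto simp: free_algebra_def lookup_restrict_letters in_keys_iff)

lemma restrict_letters_eq_0:
  "(\<And>w. w \<in> Poly_Mapping.keys f \<Longrightarrow> \<not> set (letters w) \<subseteq> G) \<Longrightarrow> restrict_letters G f = 0"
  by (rule poly_mapping_eqI) (auto simp: lookup_restrict_letters in_keys_iff)

lemma restrict_letters_gen: "a \<notin> G \<Longrightarrow> restrict_letters G (gen a) = 0"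
  by (rule restrict_letters_eq_0) (simp add: gen_def)

text \<open>A word with a letter outside \<open>G\<close> keeps that letter in any product, so the
  discarded parts of both factors contribute nothing.\<close>

lemma restrict_letters_mult: "restrict_letters G (f * g) = restrict_letters G f * restrict_letters G g"
proof -
  let ?r = "restrict_letters G"
  have bad: "\<not> set (letters w) \<subseteq> G" if "w \<in> Poly_Mapping.keys (h - ?r h)" for h w
    using that by (auto simp: in_keys_iff lookup_minus lookup_restrict_letters split: if_splits)
  have 1: "?r ((h - ?r h) * h') = 0" for h h'
    using keys_mult[of "h - ?r h" h'] bad
    by (intro restrict_letters_eq_0) (fastforce simp: plus_word_def)
  have 2: "?r (h' * (h - ?r h)) = 0" for h h'
    using keys_mult[of h' "h - ?r h"] bad
    by (intro restrict_letters_eq_0) (fastforce simp: plus_word_def)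
  have "f * g = ?r f * ?r g + (?r f * (g - ?r g) + (f - ?r f) * g)"
    by (simp add: algebra_simps)
  then have "?r (f * g) = ?r (?r f * ?r g)"
    using 1 2 by (metis restrict_letters_add add.right_neutral)
  then show ?thesis
    by (simp add: restrict_letters_ident restrict_letters_closed)
qed

section \<open>Signs, exchanges of entries, and powers\<close>

definition parity_sign :: "int \<Rightarrow> 'r::ring_1" where
  "parity_sign c = (if even c then 1 else - 1)"

lemma parity_sign_cases: "parity_sign c = 1 \<or> parity_sign c = - 1"
  by (simp add: parity_sign_def)

lemma parity_sign_comm: "parity_sign c * x = x * parity_sign c"
  by (simp add: parity_sign_def)

lemma parity_sign_square: "parity_sign c * (parity_sign c * x) = x"
  by (simp add: parity_sign_def)

lemma swap_append: "swap (Suc (length a)) (a @ p # q # b) = a @ q # p # b"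
  by (simp add: swap_def col_def nth_append list_update_append)

lemma swap_swap: "1 \<le> r \<Longrightarrow> r < length i \<Longrightarrow> swap r (swap r i) = i"
  by (auto intro!: nth_equalityI simp: swap_def col_def nth_list_update)

lemma nth_swap_other: "k \<noteq> n \<Longrightarrow> k \<noteq> Suc n \<Longrightarrow> swap (Suc n) i ! k = i ! k"
  by (simp add: swap_def)

lemma col_append: "col (a @ p # b) (Suc (length a)) = p" "col (a @ p # q # b) (Suc (Suc (length a))) = q"
  "col (a @ p # q # s # b) (Suc (Suc (Suc (length a)))) = s"
  by (simp_all add: col_def nth_append)

lemma quotient_proj_pow: "n \<noteq> 0 \<Longrightarrow> quotient_proj I (a ^ n) = quotient_proj I a ^ n"
proof (induction n)
  case (Suc n)
  then show ?case by (cases "n = 0") (simp_all add: quotient_proj_simps)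
qed simp

lemma free_algebra_pow_closed:
  "f \<in> carrier (free_algebra G) \<Longrightarrow> f ^ n \<in> carrier (free_algebra G)"
  by (induction n) simp_all

lemma coset_eq_zero:
  assumes "ideal I R" "a \<in> I"
  shows "I +>\<^bsub>R\<^esub> a = \<zero>\<^bsub>R Quot I\<^esub>"
proof -
  interpret ideal I R by fact
  show ?thesis using a_rcos_const[OF assms(2)] by (simp add: FactRing_def)
qed

lemma ring_hom_nat_pow:
  assumes "h \<in> ring_hom R S" "ring R" "ring S" "a \<in> carrier R"
  shows "h (a [^]\<^bsub>R\<^esub> (n :: nat)) = h a [^]\<^bsub>S\<^esub> n"
proof -
  interpret R: ring R by fact
  interpret S: ring S by fact
  show ?thesis
    using assms(4) by (induction n) (simp_all add: ring_hom_one[OF assms(1)] ring_hom_mult[OF assms(1)])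
qed

lemma free_algebra_nat_pow:
  fixes f :: "'b word \<Rightarrow>\<^sub>0 'c::field"
  shows "f [^]\<^bsub>free_algebra G\<^esub> (n :: nat) = f ^ n"
proof -
  interpret ring "free_algebra G :: ('b word \<Rightarrow>\<^sub>0 'c) ring" by (rule ring_free_algebra)
  show ?thesis by (induction n) (simp_all add: power_commutes)
qed

section \<open>The map from the free algebra to the cyclotomic quotient\<close>

lemma klr_class_hom: "klr_class \<nu> \<in> ring_hom (free_algebra (klr_gens \<nu>)) (klr \<nu>)"
  unfolding klr_class_def klr_def by (rule ideal.rcos_ring_hom[OF ideal_klr_ideal])

lemma cyc_class_hom: "cyc_class \<nu> \<Lambda> \<in> ring_hom (klr \<nu>) (cyc_klr \<nu> \<Lambda>)"
  unfolding cyc_class_def cyc_klr_def by (rule ideal.rcos_ring_hom[OF ideal_cyc_ideal])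

definition cyc_map :: "int multiset \<Rightarrow> int multiset \<Rightarrow> 'k::field klr_free \<Rightarrow> 'k klr_free set set" where
  "cyc_map \<nu> \<Lambda> f = cyc_class \<nu> \<Lambda> (klr_class \<nu> f)"

lemma cyc_map_hom: "cyc_map \<nu> \<Lambda> \<in> ring_hom (free_algebra (klr_gens \<nu>)) (cyc_klr \<nu> \<Lambda>)"
  using ring_hom_trans[OF klr_class_hom[of \<nu>] cyc_class_hom[of \<nu> \<Lambda>]]
  by (simp add: cyc_map_def[abs_def] comp_def)

lemma cyc_map_nat_pow:
  "f \<in> carrier (free_algebra (klr_gens \<nu>)) \<Longrightarrow> cyc_map \<nu> \<Lambda> (f ^ n) = cyc_map \<nu> \<Lambda> f [^]\<^bsub>cyc_klr \<nu> \<Lambda>\<^esub> n"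
  using ring_hom_nat_pow[OF cyc_map_hom ring_free_algebra ring_cyc_klr]
  by (simp add: free_algebra_nat_pow)

lemma cyc_map_relator:
  assumes "f \<in> klr_relators \<nu>"
  shows "cyc_map \<nu> \<Lambda> f = \<zero>\<^bsub>cyc_klr \<nu> \<Lambda>\<^esub>"
proof -
  have "f \<in> klr_ideal \<nu>"
    using ring.genideal_self[OF ring_free_algebra klr_relators_closed] assms
    unfolding klr_ideal_def by blast
  then have "klr_class \<nu> f = \<zero>\<^bsub>klr \<nu>\<^esub>"
    unfolding klr_class_def klr_def by (rule coset_eq_zero[OF ideal_klr_ideal])
  then show ?thesis
    using ring_hom_zero[OF cyc_class_hom ring_klr ring_cyc_klr] by (simp add: cyc_map_def)
qed

text \<open>The exponent 0 is written out as \<open>ee i\<close>, since the zeroth power in the free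
  algebra is its unit.\<close>

lemma cyc_map_cyclotomic:
  assumes i: "i \<in> Seq \<nu>" "i \<noteq> []"
  shows "cyc_map \<nu> \<Lambda> (if count \<Lambda> (i ! 0) = 0 then ee i else xx 1 i ^ count \<Lambda> (i ! 0) :: 'k::field klr_free)
    = \<zero>\<^bsub>cyc_klr \<nu> \<Lambda>\<^esub>"
proof -
  have size: "1 \<le> size \<nu>" if "i \<in> Seq \<nu>" "i \<noteq> []" for i
    using that by (cases i) (auto simp: permutations_of_multiset_def)
  let ?n = "count \<Lambda> (i ! 0)"
  let ?S = "{dot_pow \<nu> 1 i (count \<Lambda> (col i 1)) | i. i \<in> Seq \<nu> \<and> i \<noteq> []} :: 'k klr_free set set"
  have S: "?S \<subseteq> carrier (klr \<nu>)"
    using size by (auto intro!: dot_pow_closed)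
  have "(dot_pow \<nu> 1 i ?n :: 'k klr_free set) = dot_pow \<nu> 1 i (count \<Lambda> (col i 1))"
    by (simp add: col_def)
  then have "dot_pow \<nu> 1 i ?n \<in> ?S"
    using i by blast
  then have "(dot_pow \<nu> 1 i ?n :: 'k klr_free set) \<in> cyc_ideal \<nu> \<Lambda>"
    unfolding cyc_ideal_def by (rule subsetD[OF ring.genideal_self[OF ring_klr S]])
  then have "cyc_class \<nu> \<Lambda> (dot_pow \<nu> 1 i ?n :: 'k klr_free set) = \<zero>\<^bsub>cyc_klr \<nu> \<Lambda>\<^esub>"
    unfolding cyc_class_def cyc_klr_def by (rule coset_eq_zero[OF ideal_cyc_ideal])
  moreover have "klr_class \<nu> (xx 1 i ^ n :: 'k klr_free) = klr_class \<nu> (xx 1 i) [^]\<^bsub>klr \<nu>\<^esub> n" for n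
    using ring_hom_nat_pow[OF klr_class_hom ring_free_algebra ring_klr, of "xx 1 i" \<nu> n] i size[OF i]
    by (simp add: free_algebra_nat_pow)
  ultimately show ?thesis
    by (cases "?n = 0") (simp_all only: dot_pow_def cyc_map_def if_True if_False simp_thms)
qed

lemma cyc_dot_pow_eq:
  assumes "i \<in> Seq \<nu>" "1 \<le> r" "r \<le> size \<nu>"
  shows "cyc_dot_pow \<nu> \<Lambda> r i n = cyc_map \<nu> \<Lambda> (if n = 0 then ee i else xx r i ^ n)"
  using assms by (simp add: cyc_dot_pow_def cyc_map_nat_pow) (simp add: cyc_map_def)

text \<open>\<open>cyc_map\<close> is a homomorphism on the carrier; composition with the retraction
  yields an ideal of the whole ring type, as the passage to \<open>all_quotients\<close>
  requires.\<close>

definition cyc_kernel :: "int multiset \<Rightarrow> int multiset \<Rightarrow> 'k::field klr_free set" where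
  "cyc_kernel \<nu> \<Lambda> = {f. cyc_map \<nu> \<Lambda> (restrict_letters (klr_gens \<nu>) f) = \<zero>\<^bsub>cyc_klr \<nu> \<Lambda>\<^esub>}"

lemma cyc_kernel_iff:
  "f \<in> carrier (free_algebra (klr_gens \<nu>)) \<Longrightarrow>
    f \<in> cyc_kernel \<nu> \<Lambda> \<longleftrightarrow> cyc_map \<nu> \<Lambda> f = \<zero>\<^bsub>cyc_klr \<nu> \<Lambda>\<^esub>"
  by (simp add: cyc_kernel_def restrict_letters_ident)

lemma two_sided_cyc_kernel: "two_sided (cyc_kernel \<nu> \<Lambda>)"
proof (rule two_sidedI)
  interpret R: ring "cyc_klr \<nu> \<Lambda> :: 'a klr_free set set ring" by (rule ring_cyc_klr)
  note hom = ring_hom_closed[OF cyc_map_hom] ring_hom_mult[OF cyc_map_hom, simplified]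
    ring_hom_add[OF cyc_map_hom, simplified]
  show "(0 :: 'a klr_free) \<in> cyc_kernel \<nu> \<Lambda>"
    using ring_hom_zero[OF cyc_map_hom ring_free_algebra ring_cyc_klr]
    by (simp add: cyc_kernel_iff)
  fix a :: "'a klr_free"
  assume a: "a \<in> cyc_kernel \<nu> \<Lambda>"
  show "a + b \<in> cyc_kernel \<nu> \<Lambda>" if "b \<in> cyc_kernel \<nu> \<Lambda>" for b
    using a that by (simp add: cyc_kernel_def restrict_letters_add restrict_letters_closed hom)
  show "x * a \<in> cyc_kernel \<nu> \<Lambda>" "a * x \<in> cyc_kernel \<nu> \<Lambda>" for x
    using a by (simp_all add: cyc_kernel_def restrict_letters_mult restrict_letters_closed hom)
qed

abbreviation cyc_proj :: "int multiset \<Rightarrow> int multiset \<Rightarrow> 'k::field klr_free \<Rightarrow> 'k klr_free all_quotients"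
  where "cyc_proj \<nu> \<Lambda> \<equiv> quotient_proj (cyc_kernel \<nu> \<Lambda>)"

lemma cyc_proj_eq_0:
  "f \<in> carrier (free_algebra (klr_gens \<nu>)) \<Longrightarrow>
    cyc_proj \<nu> \<Lambda> f = 0 \<longleftrightarrow> cyc_map \<nu> \<Lambda> f = \<zero>\<^bsub>cyc_klr \<nu> \<Lambda>\<^esub>"
  by (simp add: quotient_proj_eq_0_iff[OF two_sided_cyc_kernel] cyc_kernel_iff)

lemma cyc_proj_relator: "f \<in> klr_relators \<nu> \<Longrightarrow> cyc_proj \<nu> \<Lambda> f = 0"
  by (simp add: cyc_proj_eq_0 cyc_map_relator subsetD[OF klr_relators_closed])

lemma cyc_proj_gen:
  fixes \<nu> \<Lambda> :: "int multiset"
  assumes "a \<notin> klr_gens \<nu>"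
  shows "cyc_proj \<nu> \<Lambda> (gen a :: 'k::field klr_free) = 0"
proof -
  have "restrict_letters (klr_gens \<nu>) (0 :: 'k klr_free) = 0"
    by (simp add: restrict_letters_ident)
  moreover have "(0 :: 'k klr_free) \<in> cyc_kernel \<nu> \<Lambda>"
    by (rule two_sided_D(1)[OF two_sided_cyc_kernel])
  ultimately have "(gen a :: 'k klr_free) \<in> cyc_kernel \<nu> \<Lambda>"
    by (simp add: cyc_kernel_def restrict_letters_gen[OF assms])
  then show ?thesis
    by (simp add: quotient_proj_eq_0_iff[OF two_sided_cyc_kernel])
qed

text \<open>Relations of the cyclotomic quotient, as equations in a ring type. Generators with
  invalid indices are 0, which frees several relations of side conditions. The idempotents need not
  sum to 1, as the embedding of the quotient is not unital.\<close>

locale cyclotomic_representation =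
  fixes E :: "int list \<Rightarrow> 'r::ring_1" and X D :: "nat \<Rightarrow> int list \<Rightarrow> 'r"
    and \<nu> :: "int multiset" and W U V :: "int \<Rightarrow> nat"
  assumes E_outside: "i \<notin> Seq \<nu> \<Longrightarrow> E i = 0"
    and X_outside: "\<not> (i \<in> Seq \<nu> \<and> 1 \<le> r \<and> r \<le> size \<nu>) \<Longrightarrow> X r i = 0"
    and D_outside: "\<not> (i \<in> Seq \<nu> \<and> 1 \<le> r \<and> r < size \<nu>) \<Longrightarrow> D r i = 0"
    and E_E: "E i * E i = E i"
    and E_orth: "i \<noteq> j \<Longrightarrow> E i * E j = 0"
    and X_E: "X r i = E i * X r i * E i"
    and D_E: "D r i = E (swap r i) * D r i * E i"
    and X_X: "X r i * X t i = X t i * X r i"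
    and D_X_far: "t \<noteq> r \<Longrightarrow> t \<noteq> r + 1 \<Longrightarrow> D r i * X t i = X t (swap r i) * D r i"
    and D_D_same: "i \<in> Seq \<nu> \<Longrightarrow> 1 \<le> r \<Longrightarrow> r < size \<nu> \<Longrightarrow> col i r = col i (r + 1) \<Longrightarrow>
      D r (swap r i) * D r i = 0"
    and D_D_far: "i \<in> Seq \<nu> \<Longrightarrow> 1 \<le> r \<Longrightarrow> r < size \<nu> \<Longrightarrow> cartan (col i r) (col i (r + 1)) = 0 \<Longrightarrow>
      D r (swap r i) * D r i = E i"
    and D_D_adj: "i \<in> Seq \<nu> \<Longrightarrow> 1 \<le> r \<Longrightarrow> r < size \<nu> \<Longrightarrow> cartan (col i r) (col i (r + 1)) = - 1 \<Longrightarrow>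
      D r (swap r i) * D r i = X r i + X (r + 1) i"
    and slide1: "i \<in> Seq \<nu> \<Longrightarrow> 1 \<le> r \<Longrightarrow> r < size \<nu> \<Longrightarrow> col i r \<noteq> col i (r + 1) \<Longrightarrow>
      X r (swap r i) * D r i = D r i * X (r + 1) i"
    and slide2: "i \<in> Seq \<nu> \<Longrightarrow> 1 \<le> r \<Longrightarrow> r < size \<nu> \<Longrightarrow> col i r \<noteq> col i (r + 1) \<Longrightarrow>
      X (r + 1) (swap r i) * D r i = D r i * X r i"
    and slide_same: "i \<in> Seq \<nu> \<Longrightarrow> 1 \<le> r \<Longrightarrow> r < size \<nu> \<Longrightarrow> col i r = col i (r + 1) \<Longrightarrow>
      D r i * X r i - X (r + 1) i * D r i = E i"
    and D_braid: "i \<in> Seq \<nu> \<Longrightarrow> 1 \<le> r \<Longrightarrow> r + 1 < size \<nu> \<Longrightarrow>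
      col i r = col i (r + 2) \<Longrightarrow> cartan (col i r) (col i (r + 1)) = - 1 \<Longrightarrow>
      D r (swap (r + 1) (swap r i)) * D (r + 1) (swap r i) * D r i
      - D (r + 1) (swap r (swap (r + 1) i)) * D r (swap (r + 1) i) * D (r + 1) i = E i"
    and cyclotomic: "i \<in> Seq \<nu> \<Longrightarrow> i \<noteq> [] \<Longrightarrow>
      (if W (i ! 0) = 0 then E i else X 1 i ^ W (i ! 0)) = 0"
    and U_step: "U c = W c + U (c + 1)"
    and V_step: "V c = W c + V (c - 1)"
begin

section \<open>Dots and crossings summed over all sequences\<close>

definition Y :: "nat \<Rightarrow> 'r" where
  "Y n = (\<Sum>i\<in>Seq \<nu>. parity_sign (i ! n) * X (Suc n) i)"

definition crossing :: "nat \<Rightarrow> 'r" where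
  "crossing n = (\<Sum>i\<in>Seq \<nu>. D (Suc n) i)"

lemma mult_parity_sign: "a * (parity_sign c * x) = parity_sign c * (a * x)"
  using parity_sign_comm[of c a] by (simp only: mult.assoc[symmetric])

lemma E_X [simp]: "E i * X r i = X r i" "X r i * E i = X r i"
proof -
  show "E i * X r i = X r i"
    by (subst (1 2) X_E) (simp add: mult.assoc[symmetric] E_E)
  show "X r i * E i = X r i"
    by (subst (1 2) X_E) (simp add: mult.assoc E_E)
qed

lemma E_D [simp]: "E (swap r i) * D r i = D r i" "D r i * E i = D r i"
proof -
  show "E (swap r i) * D r i = D r i"
    by (subst (1 2) D_E) (simp add: mult.assoc[symmetric] E_E)
  show "D r i * E i = D r i"
    by (subst (1 2) D_E) (simp add: mult.assoc E_E)
qed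

lemma X_E_orth: "i \<noteq> j \<Longrightarrow> X r i * E j = 0" "i \<noteq> j \<Longrightarrow> E j * X r i = 0"
  using E_orth[of i j] E_orth[of j i] X_E[of r i] by (metis mult.assoc mult_zero_left mult_zero_right)+

lemma D_E_orth: "i \<noteq> j \<Longrightarrow> D r i * E j = 0" "swap r i \<noteq> j \<Longrightarrow> E j * D r i = 0"
  using E_orth[of i j] E_orth[of j "swap r i"] D_E[of r i]
  by (metis mult.assoc mult_zero_left mult_zero_right)+

lemma Y_E: "Y n * E i = parity_sign (i ! n) * X (Suc n) i"
proof -
  have "Y n * E i = (\<Sum>j\<in>Seq \<nu>. if i = j then parity_sign (i ! n) * X (Suc n) i else 0)"
    unfolding Y_def sum_distrib_right by (rule sum.cong) (auto simp: mult.assoc X_E_orth)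
  then show ?thesis by (simp add: X_outside)
qed

lemma E_Y: "E i * Y n = parity_sign (i ! n) * X (Suc n) i"
proof -
  have "E i * Y n = (\<Sum>j\<in>Seq \<nu>. if i = j then parity_sign (i ! n) * X (Suc n) i else 0)"
    unfolding Y_def sum_distrib_left
    by (rule sum.cong) (auto simp: mult_parity_sign X_E_orth)
  then show ?thesis by (simp add: X_outside)
qed

lemma crossing_E: "crossing n * E i = D (Suc n) i"
proof -
  have "crossing n * E i = (\<Sum>j\<in>Seq \<nu>. if i = j then D (Suc n) i else 0)"
    unfolding crossing_def sum_distrib_right by (rule sum.cong) (auto simp: D_E_orth)
  then show ?thesis by (simp add: D_outside)
qed

lemma Y_X: "Y n * X r i = parity_sign (i ! n) * (X (Suc n) i * X r i)"
  by (metis E_X(1) Y_E mult.assoc)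

lemma Y_D: "Y n * D r i = parity_sign (swap r i ! n) * (X (Suc n) (swap r i) * D r i)"
  by (metis E_D(1) Y_E mult.assoc)

lemma crossing_X: "crossing n * X r i = D (Suc n) i * X r i"
  by (metis E_X(1) crossing_E mult.assoc)

lemma crossing_D: "crossing n * D r i = D (Suc n) (swap r i) * D r i"
  by (metis E_D(1) crossing_E mult.assoc)

lemma Y_Y: "Y n * Y k = Y k * Y n"
proof -
  have *: "Y n * Y k = (\<Sum>i\<in>Seq \<nu>. parity_sign (i ! k) * (Y n * X (Suc k) i))" for n k
    by (subst (2) Y_def) (simp only: sum_distrib_left mult_parity_sign)
  have "parity_sign (i ! k) * (Y n * X (Suc k) i) = parity_sign (i ! n) * (Y k * X (Suc n) i)" for i
    unfolding Y_X X_X[of "Suc k"] by (rule mult_parity_sign)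
  then show ?thesis unfolding * by (intro sum.cong refl)
qed

lemma crossing_Y:
  assumes "k \<noteq> n" "k \<noteq> Suc n"
  shows "crossing n * Y k = Y k * crossing n"
proof -
  have "crossing n * Y k = (\<Sum>i\<in>Seq \<nu>. parity_sign (i ! k) * (D (Suc n) i * X (Suc k) i))"
    by (subst Y_def) (simp only: sum_distrib_left mult_parity_sign[of "crossing n"] crossing_X)
  also have "\<dots> = (\<Sum>i\<in>Seq \<nu>. Y k * D (Suc n) i)"
    using assms by (intro sum.cong refl) (simp add: Y_D D_X_far nth_swap_other)
  finally show ?thesis by (simp add: crossing_def sum_distrib_left)
qed

lemma Seq_swap_iff: "a @ q # p # b \<in> Seq \<nu> \<longleftrightarrow> a @ p # q # b \<in> Seq \<nu>"
  by (simp add: permutations_of_multiset_def add_mset_commute)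

lemma Seq_valid:
  assumes "a @ p # q # b \<in> Seq \<nu>"
  shows "1 \<le> Suc (length a)" "Suc (length a) < size \<nu>"
  using assms by (auto simp: permutations_of_multiset_def)

text \<open>The left idempotent selects the crossings that end in the exchanged sequence; as
  exchanging is an involution, only the summand starting at \<open>a @ p # q # b\<close>
  survives.\<close>

lemma crossing_commute: "crossing (length a) * E (a @ p # q # b) = E (a @ q # p # b) * crossing (length a)"
proof (cases "a @ p # q # b \<in> Seq \<nu>")
  case True
  let ?r = "Suc (length a)" and ?i = "a @ p # q # b"
  have "E (a @ q # p # b) * D ?r j = (if ?i = j then D ?r ?i else 0)" if "j \<in> Seq \<nu>" for j
  proof -
    have "length j = size \<nu>"
      using that by (auto simp: permutations_of_multiset_def)
    then have "swap ?r (swap ?r j) = j"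
      using Seq_valid[OF True] by (intro swap_swap) auto
    then have "swap ?r j = a @ q # p # b \<Longrightarrow> j = ?i"
      by (metis swap_append)
    then show ?thesis
      using E_D(1)[of ?r ?i] D_E_orth(2)[of ?r j] by (auto simp: swap_append)
  qed
  then have "E (a @ q # p # b) * crossing (length a) = D ?r ?i"
    using True by (simp add: crossing_def sum_distrib_left)
  then show ?thesis by (simp only: crossing_E)
next
  case False
  then show ?thesis using Seq_swap_iff[of a q p b] by (simp add: E_outside)
qed

lemma X_pow_Suc_E: "X r i ^ Suc k * E i = X r i ^ Suc k"
  by (simp only: power_Suc2 mult.assoc E_X(2))

text \<open>The trailing idempotent selects the summand of \<open>i\<close> and keeps the case
  \<open>k = 0\<close> correct; signs are central and collect in front.\<close>

lemma Y_pow_E: "Y n ^ k * E i = parity_sign (i ! n) ^ k * (X (Suc n) i ^ k * E i)"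
proof (induction k)
  case (Suc k)
  let ?s = "parity_sign (i ! n) :: 'r" and ?X = "X (Suc n) i"
  have "Y n ^ Suc k * E i = Y n * ?s ^ k * (?X ^ k * E i)"
    by (simp add: mult.assoc Suc)
  also have "Y n * ?s ^ k = ?s ^ k * Y n"
    by (rule power_commuting_commutes[symmetric, OF parity_sign_comm])
  also have "?X ^ k * E i = E i * ?X ^ k"
    by (rule power_commuting_commutes) simp
  also have "?s ^ k * Y n * (E i * ?X ^ k) = ?s ^ k * (Y n * E i * ?X ^ k)"
    by (simp only: mult.assoc)
  also have "\<dots> = ?s ^ Suc k * ?X ^ Suc k"
    by (simp only: Y_E power_Suc2[of ?s] power_Suc[of ?X] mult.assoc)
  finally show ?case by (simp only: X_pow_Suc_E)
qed simp

text \<open>Each relation at an idempotent is read off there, where the sums reduce to single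
  generators; for a sequence outside \<open>Seq \<nu>\<close> both sides vanish.\<close>

sublocale klr_nilpotent E Y crossing W U parity_sign V
proof unfold_locales
  fix a b :: "int list" and p q :: int
  let ?r = "Suc (length a)"
  note valid = Seq_valid[of a]
  note simps = mult.assoc crossing_E crossing_D crossing_X Y_E Y_D Y_X swap_append col_append nth_append
  show "crossing (length a) * E (a @ p # q # b) = E (a @ q # p # b) * crossing (length a)"
    by (rule crossing_commute)
  show "crossing (length a) * crossing (length a) * E (a @ p # p # b) = 0"
    using D_D_same[of "a @ p # p # b" ?r] valid[of p p b]
    by (cases "a @ p # p # b \<in> Seq \<nu>") (auto simp: simps E_outside D_outside)
  show "crossing (length a) * crossing (length a) * E (a @ p # q # b) = E (a @ p # q # b)"
    if "\<bar>p - q\<bar> \<ge> 2"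
    using that D_D_far[of "a @ p # q # b" ?r] valid[of p q b]
    by (cases "a @ p # q # b \<in> Seq \<nu>") (auto simp: simps E_outside D_outside cartan_def)
  show "crossing (length a) * crossing (length a) * E (a @ p # q # b) =
      parity_sign p * ((Y (length a) - Y (Suc (length a))) * E (a @ p # q # b))"
    if "\<bar>p - q\<bar> = 1"
  proof -
    \<comment> \<open>Adjacent colours have opposite parity, which turns the sum of two dots into a
      difference of signed dots.\<close>
    have "parity_sign q = (- parity_sign p :: 'r)"
      using that by (auto simp: parity_sign_def abs_if split: if_splits; presburger)
    then show ?thesis
      using that D_D_adj[of "a @ p # q # b" ?r] valid[of p q b]
      by (cases "a @ p # q # b \<in> Seq \<nu>")
        (simp_all add: simps E_outside cartan_def left_diff_distrib distrib_left parity_sign_square)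
  qed
  show "Y (length a) * crossing (length a) * E (a @ p # q # b) =
      crossing (length a) * Y (Suc (length a)) * E (a @ p # q # b)" if "p \<noteq> q"
    using that slide1[of "a @ p # q # b" ?r] valid[of p q b]
    by (cases "a @ p # q # b \<in> Seq \<nu>") (auto simp: simps E_outside X_outside D_outside mult_parity_sign)
  show "Y (Suc (length a)) * crossing (length a) * E (a @ p # q # b) =
      crossing (length a) * Y (length a) * E (a @ p # q # b)" if "p \<noteq> q"
    using that slide2[of "a @ p # q # b" ?r] valid[of p q b]
    by (cases "a @ p # q # b \<in> Seq \<nu>") (auto simp: simps E_outside X_outside D_outside mult_parity_sign)
  show "crossing (length a) * Y (length a) * E (a @ p # p # b) -
      Y (Suc (length a)) * crossing (length a) * E (a @ p # p # b) = parity_sign p * E (a @ p # p # b)"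
    using slide_same[of "a @ p # p # b" ?r] valid[of p p b]
    by (cases "a @ p # p # b \<in> Seq \<nu>")
      (auto simp: simps E_outside X_outside D_outside mult_parity_sign simp flip: right_diff_distrib)
  show "crossing (length a) * crossing (Suc (length a)) * crossing (length a) * E (a @ p # q # p # b) -
      crossing (Suc (length a)) * crossing (length a) * crossing (Suc (length a)) * E (a @ p # q # p # b) =
      E (a @ p # q # p # b)" if "\<bar>p - q\<bar> = 1"
  proof (cases "a @ p # q # p # b \<in> Seq \<nu>")
    case True
    have D_assoc: "crossing n * (D r i * x) = D (Suc n) (swap r i) * (D r i * x)" for n r i x
      by (simp only: mult.assoc[symmetric] crossing_D)
    \<comment> \<open>Taking the first letter into the prefix gives the exchange one position
      further.\<close>
    have sw: "swap (Suc ?r) (a @ u # v # w # b) = a @ u # w # v # b" for u v w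
      using swap_append[of "a @ [u]" v w b] by simp
    show ?thesis
      using that True D_braid[of "a @ p # q # p # b" ?r] valid[of p q "p # b"]
        Seq_valid[of "a @ [p]" q p b]
      by (auto simp: simps D_assoc sw cartan_def)
  qed (simp add: simps E_outside D_outside)
  show "Y 0 ^ W c * E (c # b) = 0" for c
  proof (cases "c # b \<in> Seq \<nu>")
    case True
    then show ?thesis
      using cyclotomic[of "c # b"] by (auto simp: Y_pow_E split: if_splits)
  qed (simp add: E_outside)
  show "Y n * E i = E i * Y n" for n i
    by (simp only: Y_E E_Y)
qed (rule parity_sign_cases E_E Y_Y crossing_Y U_step V_step; assumption)+

theorem dot_nilpotent:
  assumes "i \<in> Seq \<nu>" "n < size \<nu>"
  shows "X (Suc n) i ^ (U (i ! n) + V (i ! n - 1)) * E i = 0"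
proof -
  let ?l = "U (i ! n) + V (i ! n - 1)"
  have n: "n < length i"
    using assms by (auto simp: permutations_of_multiset_def)
  have "parity_sign (i ! n) ^ ?l * (X (Suc n) i ^ ?l * E i) = 0"
    using Y_nilpotent[of "take n i" "i ! n" "drop (Suc n) i"] n
    by (simp add: id_take_nth_drop[symmetric] Y_pow_E min_def)
  \<comment> \<open>The power of the sign is 1 or -1 and cancels.\<close>
  then show ?thesis
    by (cases "even ?l") (auto simp: parity_sign_def split: if_splits)
qed

end

text \<open>Relators map to 0 in the cyclotomic quotient, and generators with invalid indices are
  killed by the retraction; together these give the relations for all indices.\<close>

lemma cyclotomic_representation:
  fixes \<nu> \<Lambda> :: "int multiset"
  shows "cyclotomic_representation (\<lambda>i. cyc_proj \<nu> \<Lambda> (ee i :: 'k::field klr_free))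
    (\<lambda>r i. cyc_proj \<nu> \<Lambda> (xx r i)) (\<lambda>r i. cyc_proj \<nu> \<Lambda> (dd r i)) \<nu>
    (count \<Lambda>) (\<lambda>c. size {#j \<in># \<Lambda>. c \<le> j#}) (\<lambda>c. size {#j \<in># \<Lambda>. j \<le> c#})"
proof
  let ?P = "cyc_proj \<nu> \<Lambda> :: 'k klr_free \<Rightarrow> _"
  let ?E = "\<lambda>i. cyc_proj \<nu> \<Lambda> (ee i :: 'k klr_free)"
    and ?X = "\<lambda>r i. cyc_proj \<nu> \<Lambda> (xx r i :: 'k klr_free)"
    and ?D = "\<lambda>r i. cyc_proj \<nu> \<Lambda> (dd r i :: 'k klr_free)"
  \<comment> \<open>\<open>rel(n)\<close> is the relation of the n-th introduction rule of
    \<open>klr_relators\<close>, turned from a vanishing difference into an equation.\<close>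
  note rel = klr_relators.intros[THEN cyc_proj_relator[of _ \<nu> \<Lambda>],
      unfolded quotient_proj_simps eq_iff_diff_eq_0[symmetric]]
  fix i j :: "int list" and r t :: nat and c :: int
  show E: "?E i = 0" if "i \<notin> Seq \<nu>" for i
    using that by (intro cyc_proj_gen) simp
  show X: "?X r i = 0" if "\<not> (i \<in> Seq \<nu> \<and> 1 \<le> r \<and> r \<le> size \<nu>)" for r i
    using that by (intro cyc_proj_gen) simp
  show D: "?D r i = 0" if "\<not> (i \<in> Seq \<nu> \<and> 1 \<le> r \<and> r < size \<nu>)" for r i
    using that by (intro cyc_proj_gen) simp
  show "?E i * ?E i = ?E i"
    using rel(1)[of i] E[of i] by (cases "i \<in> Seq \<nu>") auto
  show "?E i * ?E j = 0" if "i \<noteq> j"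
    using that rel(2)[of i j] E[of i] E[of j] by (cases "i \<in> Seq \<nu>"; cases "j \<in> Seq \<nu>") auto
  show "?X r i = ?E i * ?X r i * ?E i"
    using rel(4)[of i r] X[of i r] by (cases "i \<in> Seq \<nu> \<and> 1 \<le> r \<and> r \<le> size \<nu>") auto
  show "?D r i = ?E (swap r i) * ?D r i * ?E i"
    using rel(5)[of i r] D[of i r] by (cases "i \<in> Seq \<nu> \<and> 1 \<le> r \<and> r < size \<nu>") auto
  show "?X r i * ?X t i = ?X t i * ?X r i"
    using rel(6)[of i r t] X[of i r] X[of i t]
    by (cases "i \<in> Seq \<nu> \<and> 1 \<le> r \<and> r \<le> size \<nu> \<and> 1 \<le> t \<and> t \<le> size \<nu>") auto
  show "?D r i * ?X t i = ?X t (swap r i) * ?D r i" if "t \<noteq> r" "t \<noteq> r + 1"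
    using that rel(7)[of i r t] X[of i t] X[of "swap r i" t] D[of i r]
    by (cases "i \<in> Seq \<nu> \<and> 1 \<le> r \<and> r < size \<nu> \<and> 1 \<le> t \<and> t \<le> size \<nu>") auto
  show "?D r (swap r i) * ?D r i = 0"
    if "i \<in> Seq \<nu>" "1 \<le> r" "r < size \<nu>" "col i r = col i (r + 1)"
    using that by (rule rel)
  show "?D r (swap r i) * ?D r i = ?E i"
    if "i \<in> Seq \<nu>" "1 \<le> r" "r < size \<nu>" "cartan (col i r) (col i (r + 1)) = 0"
    using that by (rule rel)
  show "?D r (swap r i) * ?D r i = ?X r i + ?X (r + 1) i"
    if "i \<in> Seq \<nu>" "1 \<le> r" "r < size \<nu>" "cartan (col i r) (col i (r + 1)) = - 1"
    using that by (rule rel)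
  show "?X r (swap r i) * ?D r i = ?D r i * ?X (r + 1) i"
    if "i \<in> Seq \<nu>" "1 \<le> r" "r < size \<nu>" "col i r \<noteq> col i (r + 1)"
    using that by (rule rel)
  show "?X (r + 1) (swap r i) * ?D r i = ?D r i * ?X r i"
    if "i \<in> Seq \<nu>" "1 \<le> r" "r < size \<nu>" "col i r \<noteq> col i (r + 1)"
    using that by (rule rel)
  show "?D r i * ?X r i - ?X (r + 1) i * ?D r i = ?E i"
    if "i \<in> Seq \<nu>" "1 \<le> r" "r < size \<nu>" "col i r = col i (r + 1)"
    using that by (rule rel)
  show "?D r (swap (r + 1) (swap r i)) * ?D (r + 1) (swap r i) * ?D r i
      - ?D (r + 1) (swap r (swap (r + 1) i)) * ?D r (swap (r + 1) i) * ?D (r + 1) i = ?E i"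
    if "i \<in> Seq \<nu>" "1 \<le> r" "r + 1 < size \<nu>"
      "col i r = col i (r + 2)" "cartan (col i r) (col i (r + 1)) = - 1"
    using rel(16)[OF that(1-3)] that(4,5) by simp
  show "(if count \<Lambda> (i ! 0) = 0 then ?E i else ?X 1 i ^ count \<Lambda> (i ! 0)) = 0"
    if i: "i \<in> Seq \<nu>" "i \<noteq> []"
  proof -
    have "1 \<le> size \<nu>"
      using i by (cases i) (auto simp: permutations_of_multiset_def)
    then have "?P (if count \<Lambda> (i ! 0) = 0 then ee i else xx 1 i ^ count \<Lambda> (i ! 0)) = 0"
      using i cyc_map_cyclotomic[OF i, of \<Lambda>, where 'k = 'k]
      by (subst cyc_proj_eq_0) (auto intro!: free_algebra_pow_closed simp del: One_nat_def)
    then show ?thesis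
      by (cases "count \<Lambda> (i ! 0) = 0") (simp_all only: quotient_proj_pow if_True if_False simp_thms)
  qed
  show "size {#j \<in># \<Lambda>. c \<le> j#} = count \<Lambda> c + size {#j \<in># \<Lambda>. c + 1 \<le> j#}"
    by (induction \<Lambda>) auto
  show "size {#j \<in># \<Lambda>. j \<le> c#} = count \<Lambda> c + size {#j \<in># \<Lambda>. j \<le> c - 1#}"
    by (induction \<Lambda>) auto
qed

theorem corollary2p17:
  fixes \<Lambda> \<nu> :: "int multiset" and i :: "int list" and r :: nat
  assumes "i \<in> Seq \<nu>" and "1 \<le> r" and "r \<le> size \<nu>"
  shows "(cyc_dot_pow \<nu> \<Lambda> r i (size \<Lambda>) :: 'k::field klr_free set set) = \<zero>\<^bsub>cyc_klr \<nu> \<Lambda>\<^esub>"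
proof -
  let ?P = "cyc_proj \<nu> \<Lambda> :: 'k klr_free \<Rightarrow> _" and ?l = "size \<Lambda>" and ?c = "i ! (r - 1)"
  interpret cyclotomic_representation "\<lambda>i. ?P (ee i)" "\<lambda>r i. ?P (xx r i)" "\<lambda>r i. ?P (dd r i)" \<nu>
    "count \<Lambda>" "\<lambda>c. size {#j \<in># \<Lambda>. c \<le> j#}" "\<lambda>c. size {#j \<in># \<Lambda>. j \<le> c#}"
    by (rule cyclotomic_representation)
  \<comment> \<open>The weights at least \<open>?c\<close> and those below it make up
    \<open>\<Lambda>\<close>, so the two exponents add up to the level.\<close>
  have "size {#j \<in># \<Lambda>. ?c \<le> j#} + size {#j \<in># \<Lambda>. j \<le> ?c - 1#} = ?l"
    by (induction \<Lambda>) auto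
  then have 0: "?P (xx r i) ^ ?l * ?P (ee i) = 0"
    using dot_nilpotent[of i "r - 1"] assms by simp
  \<comment> \<open>At level 0 the power means the idempotent, which is what \<open>0\<close> says
    then; at positive level the idempotent is absorbed by the dot.\<close>
  have "?P (if ?l = 0 then ee i else xx r i ^ ?l) = 0"
  proof (cases ?l)
    case (Suc n)
    then show ?thesis
      using 0 X_pow_Suc_E[of r i n] quotient_proj_pow[of ?l "cyc_kernel \<nu> \<Lambda>" "xx r i :: 'k klr_free"]
      by (simp del: power_Suc)
  qed (use 0 in simp)
  then show ?thesis
    using assms by (subst (asm) cyc_proj_eq_0) (auto simp: cyc_dot_pow_eq intro: free_algebra_pow_closed)
qed

end
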